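(* Let $\mu$ be the uniform probability measure on $[-1,+1]$. Then, for any probability measure $d\nu=h\,d\mu$, where $h$ is a smooth probability density, admitting a Stein kernel $\tau_\nu$ with respect to $\mu$ (as defined in the context), $$ {\rm H}(\nu\,|\,\mu)\,\le\,{\rm S}^2(\nu\,|\,\mu)\,\Psi\bigg(\frac{{\rm I}(\nu\,|\,\mu)}{2\,{\rm S}^2(\nu\,|\,\mu)}\bigg). $$
   Context: $\Psi:\mathbb{R}_+\to\mathbb{R}_+$ is defined by $\Psi(r)=1+\log r$ if $r\ge1$ and $\Psi(r)=r$ if $0\le r\le1$. $\mu$ is the invariant measure of the Jacobi operator $\mathcal{L}f=(1-x^2)f''-2xf'$, with carr\'e du champ $\Gamma(f)=(1-x^2)f'^2$. A function $\tau_\nu\in L^1(\nu)$ is a Stein kernel for $\nu$ with respect to $\mu$ if, for every smooth test function $f$, $$\int2x\,f'(x)\,d\nu(x)=\int\tau_\nu(x)\,f''(x)\,d\nu(x).$$ The Stein discrepancy is ${\rm S}(\nu|\mu)=\Big(\int\big(\frac{\tau_\nu(x)}{1-x^2}-1\big)^2d\nu(x)\Big)^{1/2}$. Also ${\rm H}(\nu|\mu)=\int h\log h\,d\mu$ and ${\rm I}(\nu|\mu)=\int(1-x^2)\frac{h'^2}{h}\,d\mu$. *)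

theory Defs
  imports "HOL-Probability.Probability"
begin

text \<open>The state space is the closed interval itself, so that measurability and integrals
  never depend on values of functions outside \<open>[-1, 1]\<close>.\<close>

abbreviation E :: "real set" where
  "E \<equiv> {-1..1}"

definition \<mu> :: "real measure" where
  "\<mu> = uniform_measure (restrict_space lborel E) E"

text \<open>Derivative of a function on \<open>[-1, 1]\<close>, one-sided at the endpoints.\<close>

definition D :: "(real \<Rightarrow> real) \<Rightarrow> real \<Rightarrow> real" where
  "D f x = vector_derivative f (at x within E)"

definition smooth :: "(real \<Rightarrow> real) \<Rightarrow> bool" where
  "smooth f \<longleftrightarrow> (\<forall>n. ((D ^^ n) f) differentiable_on E)"

definition stein_kernel :: "real measure \<Rightarrow> (real \<Rightarrow> real) \<Rightarrow> bool" where
  "stein_kernel \<nu> \<tau> \<longleftrightarrow> integrable \<nu> \<tau> \<and>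
     (\<forall>f. smooth f \<longrightarrow> (\<integral>x. 2 * x * D f x \<partial>\<nu>) = (\<integral>x. \<tau> x * D (D f) x \<partial>\<nu>))"

definition esqrt :: "ennreal \<Rightarrow> ennreal" where
  "esqrt r = (if r = \<infinity> then \<infinity> else ennreal (sqrt (enn2real r)))"

text \<open>The discrepancy may be infinite. The endpoints, where the quotient is a division by zero,
  are null for every measure with a density with respect to \<open>\<mu>\<close>.\<close>

definition stein_discrepancy :: "real measure \<Rightarrow> (real \<Rightarrow> real) \<Rightarrow> ennreal" where
  "stein_discrepancy \<nu> \<tau> = esqrt (\<integral>\<^sup>+ x. ennreal ((\<tau> x / (1 - x\<^sup>2) - 1)\<^sup>2) \<partial>\<nu>)"

text \<open>As functions of the density \<open>h\<close> of \<open>\<nu>\<close> with respect to \<open>\<mu>\<close>. Since \<open>ln 0 = 0\<close> and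
  division by zero gives zero, both integrands vanish where \<open>h\<close> does. For smooth \<open>h \<ge> 0\<close> the first
  integrand is continuous, and \<open>h' = 0\<close> at every interior zero of \<open>h\<close>.\<close>

definition entropy_H :: "(real \<Rightarrow> real) \<Rightarrow> real" where
  "entropy_H h = (\<integral>x. h x * ln (h x) \<partial>\<mu>)"

definition fisher_I :: "(real \<Rightarrow> real) \<Rightarrow> ennreal" where
  "fisher_I h = (\<integral>\<^sup>+ x. ennreal ((1 - x\<^sup>2) * (D h x)\<^sup>2 / h x) \<partial>\<mu>)"

definition \<Psi> :: "real \<Rightarrow> real" where
  "\<Psi> r = (if 1 \<le> r then 1 + ln r else r)"

definition ePsi :: "ennreal \<Rightarrow> ennreal" where
  "ePsi r = (if r = \<infinity> then \<infinity> else ennreal (\<Psi> (enn2real r)))"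

text \<open>The value of \<open>S\<^sup>2 \<Psi>(I / (2 S\<^sup>2))\<close>. For \<open>S = \<infinity>\<close> it is the limit \<open>I / 2\<close> as \<open>S\<close> grows
  (once \<open>2 S\<^sup>2 \<ge> I\<close> the expression equals \<open>I / 2\<close>), not the \<open>\<infinity> * 0 = 0\<close> of \<open>ennreal\<close>
  arithmetic. For \<open>S = 0\<close> it is \<open>0\<close>, which is the limit as \<open>S\<close> tends to \<open>0\<close> for finite \<open>I\<close>.\<close>

definition HSI_bound :: "ennreal \<Rightarrow> ennreal \<Rightarrow> ennreal" where
  "HSI_bound S I = (if S = \<infinity> then I / 2 else S\<^sup>2 * ePsi (I / (2 * S\<^sup>2)))"

lemma space_mu [simp]: "space \<mu> = E"
  by (simp add: \<mu>_def space_restrict_space)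

lemma prob_space_mu: "prob_space \<mu>"
  unfolding \<mu>_def
  by (rule prob_space_uniform_measure) (simp_all add: emeasure_restrict_space)

lemma nn_integral_mu: "integral\<^sup>N \<mu> f = (\<integral>\<^sup>+ x\<in>E. f x \<partial>lborel) / 2"
  if [measurable]: "f \<in> borel_measurable (restrict_space lborel E)"
proof -
  have "emeasure (restrict_space lborel E) E = 2"
    by (simp add: emeasure_restrict_space)
  then have "integral\<^sup>N \<mu> f = (\<integral>\<^sup>+ x\<in>E. f x \<partial>restrict_space lborel E) / 2"
    unfolding \<mu>_def by (subst nn_integral_uniform_measure) (auto simp: sets_restrict_space)
  then show ?thesis
    by (simp add: nn_integral_restrict_space mult.assoc flip: indicator_inter_arith)
qed

lemma D_unique:
  assumes "(f has_real_derivative y) (at x within E)" "x \<in> E"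
  shows "D f x = y"
  unfolding D_def
  using assms vector_derivative_within_cbox[of "-1" 1 x f y]
  by (auto simp: has_real_derivative_iff_has_vector_derivative)

lemma esqrt_power2: "(esqrt r)\<^sup>2 = r"
  by (cases r) (auto simp: esqrt_def ennreal_power top_power_ennreal)

end

theory Submission
  imports Defs
begin

text \<open>
  Write \<open>a = 1 - x\<^sup>2\<close>, \<open>\<Gamma> f = a f'\<^sup>2\<close> and \<open>L f = (a f')'\<close>, and let \<open>P\<^sub>t\<close> be the semigroup generated
  by \<open>L\<close>. Minimising \<open>\<theta> I / 2 - S\<^sup>2 ln \<theta>\<close> over \<open>0 < \<theta> \<le> 1\<close> gives exactly \<open>S\<^sup>2 \<Psi> (I / (2 S\<^sup>2))\<close>
  (the minimiser is \<open>\<theta> = 2 S\<^sup>2 / I\<close> when this is at most \<open>1\<close>, and \<open>\<theta> = 1\<close> otherwise), so it is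
  enough to show \<open>H \<le> \<theta> I / 2 - S\<^sup>2 ln \<theta>\<close> for each \<open>\<theta>\<close>. With \<open>h\<^sub>t = P\<^sub>t h\<close> the entropy dissipates at
  rate \<open>- d/dt H(h\<^sub>t) = I(h\<^sub>t)\<close>, and \<open>I(h\<^sub>t)\<close> is bounded in two ways.

  For small times, \<open>\<Gamma>\<^sub>2 \<ge> \<Gamma>\<close> gives \<open>I(h\<^sub>t) \<le> exp (- 2 t) I(h)\<close>; on \<open>[0, u]\<close> this contributes
  \<open>\<theta> I / 2\<close>, where \<open>\<theta> = 1 - exp (- 2 u)\<close>. Taking \<open>u = \<infinity>\<close> also gives the logarithmic Sobolev
  inequality \<open>H \<le> I / 2\<close>, which is the case \<open>\<theta> = 1\<close>.

  For large times the Stein kernel enters. Put \<open>v = ln h\<^sub>t\<close> and \<open>f = P\<^sub>t v\<close>. By symmetry of \<open>P\<^sub>t\<close>,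
  \<open>I(h\<^sub>t) = - \<integral> L v h\<^sub>t d\<mu> = - \<integral> L f d\<nu>\<close>, and the kernel identity turns this into
  \<open>\<integral> (\<tau> / a - 1) a f'' d\<nu>\<close>. The Cauchy-Schwarz inequality and the pointwise bound
  \<open>(a (P\<^sub>t v)'')\<^sup>2 \<le> 2 / (exp (2 t) - 1) P\<^sub>t (\<Gamma> v)\<close> then yield
  \<open>I(h\<^sub>t) \<le> 2 / (exp (2 t) - 1) S\<^sup>2\<close>, because \<open>\<integral> P\<^sub>t (\<Gamma> v) d\<nu> = \<integral> \<Gamma> v h\<^sub>t d\<mu> = I(h\<^sub>t)\<close>. The
  integral of this rate over \<open>[u, \<infinity>)\<close> is \<open>- S\<^sup>2 ln \<theta>\<close>.

  The operator \<open>L\<close> maps polynomials of degree at most \<open>n\<close> to themselves and is diagonalisable there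
  with eigenvalues \<open>- k (k + 1)\<close>, so on polynomials \<open>P\<^sub>t\<close> is a finite sum of exponentials
  (\<open>heat\<close>). Positivity and the Hessian bound follow from the parabolic maximum principle
  (\<open>max_principle\<close>, \<open>heat_gradient_hessian_bound\<close>), and the dissipation identities from
  differentiation under the integral sign (\<open>poly_entropy_deriv\<close>, \<open>poly_fisher_deriv\<close>). In general neither \<open>h\<close>
  nor \<open>ln h\<^sub>t\<close> is a polynomial. Both are replaced by polynomials that are close in \<open>C\<^sup>2\<close>; to keep the
  errors uniform, the Stein inequality is used in a form that is linear in the density
  (\<open>stein_bound\<close>, \<open>stein_heat_bound\<close>, \<open>stein_fisher_bound\<close>). This needs \<open>h\<close> bounded away from
  \<open>0\<close>. The general case uses the mixtures \<open>(1 - \<delta>) h + \<delta>\<close>, for which the Stein inequality persists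
  and the Fisher information does not increase.

  The calculus is done with Lebesgue integrals over \<open>[-1, 1]\<close>, which are twice the integrals
  against \<open>\<mu>\<close>; in that normalisation densities have mass \<open>2\<close>.
\<close>

section \<open>The Jacobi operator on polynomials and its spectral decomposition\<close>


definition jacobi :: "real poly \<Rightarrow> real poly" where
  "jacobi p = [:1, 0, -1:] * pderiv (pderiv p) - [:0, 2:] * pderiv p"

lemma poly_jacobi:
  "poly (jacobi p) x = (1 - x\<^sup>2) * poly (pderiv (pderiv p)) x - 2 * x * poly (pderiv p) x"
  by (simp add: jacobi_def power2_eq_square algebra_simps)

lemma poly_pderiv_jacobi:
  "poly (pderiv (jacobi p)) x = (1 - x\<^sup>2) * poly (pderiv (pderiv (pderiv p))) x
     - 4 * x * poly (pderiv (pderiv p)) x - 2 * poly (pderiv p) x"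
  by (simp add: jacobi_def pderiv_mult pderiv_add pderiv_diff pderiv_minus pderiv_pCons pderiv_smult power2_eq_square algebra_simps del: mult_pCons_left)

lemma poly_pderiv_pderiv_jacobi:
  "poly (pderiv (pderiv (jacobi p))) x = (1 - x\<^sup>2) * poly (pderiv (pderiv (pderiv (pderiv p)))) x
     - 6 * x * poly (pderiv (pderiv (pderiv p))) x - 6 * poly (pderiv (pderiv p)) x"
  by (simp add: jacobi_def pderiv_mult pderiv_add pderiv_diff pderiv_minus pderiv_pCons pderiv_smult power2_eq_square algebra_simps del: mult_pCons_left)

lemma pderiv_sum: "pderiv (sum f A) = (\<Sum>x\<in>A. pderiv (f x))"
  by (induction A rule: infinite_finite_induct) (auto simp: pderiv_add)

lemma smult_sum_right: "smult c (sum f A) = (\<Sum>x\<in>A. smult c (f x))"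
  by (induction A rule: infinite_finite_induct) (auto simp: smult_add_right)

lemma jacobi_add: "jacobi (p + q) = jacobi p + jacobi q"
  and jacobi_diff: "jacobi (p - q) = jacobi p - jacobi q"
  and jacobi_smult: "jacobi (smult c p) = smult c (jacobi p)"
  unfolding jacobi_def
  by (simp_all only: pderiv_add pderiv_diff pderiv_smult ring_distribs smult_diff_right mult_smult_right mult_smult_left algebra_simps)

lemma jacobi_0 [simp]: "jacobi 0 = 0"
  by (simp add: jacobi_def)

lemma jacobi_sum: "jacobi (sum f A) = (\<Sum>x\<in>A. jacobi (f x))"
  by (induction A rule: infinite_finite_induct) (auto simp: jacobi_add)

text \<open>Triangularity in the monomial basis: the coefficient of degree \<open>n\<close> only sees those of degree
  \<open>n\<close> and \<open>n + 2\<close>. Hence \<open>L + n (n + 1)\<close> lowers the degree of a polynomial of degree \<open>n\<close>.\<close>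

lemma coeff_jacobi:
  "coeff (jacobi p) n = real (n + 2) * real (n + 1) * coeff p (n + 2) - real n * real (n + 1) * coeff p n"
proof -
  have "jacobi p = pderiv (pderiv p) - pCons 0 (pCons 0 (pderiv (pderiv p))) - pCons 0 (smult 2 (pderiv p))"
    by (simp add: jacobi_def)
  then have "coeff (jacobi p) n = coeff (pderiv (pderiv p)) n
      - coeff (pCons 0 (pCons 0 (pderiv (pderiv p)))) n - coeff (pCons 0 (smult 2 (pderiv p))) n"
    by (simp only: coeff_diff)
  then show ?thesis
    by (simp only: coeff_pCons coeff_smult coeff_pderiv split: nat.split) (auto simp: algebra_simps)
qed

abbreviation eigenvalue :: "nat \<Rightarrow> real" where
  "eigenvalue k \<equiv> real k * (real k + 1)"

text \<open>Zero components are allowed, so a polynomial of degree at most \<open>n\<close> can be written as a sum over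
  all \<open>k \<le> n\<close> without naming its non-trivial Legendre components.\<close>

definition eigen_family :: "(nat \<Rightarrow> real poly) \<Rightarrow> bool" where
  "eigen_family e \<longleftrightarrow> (\<forall>k. jacobi (e k) = smult (- eigenvalue k) (e k))"

lemma eigenvalue_inject: "eigenvalue j = eigenvalue k \<longleftrightarrow> j = k"
proof -
  have "eigenvalue j - eigenvalue k = (real j - real k) * (real j + real k + 1)"
    by (simp add: algebra_simps)
  then show ?thesis by (auto simp: add_nonneg_eq_0_iff)
qed

text \<open>By induction on the degree. For degree \<open>N\<close>, the polynomial \<open>(L + N (N + 1)) p\<close> has lower degree,
  so it is a sum of eigenvectors \<open>f\<^sub>k\<close> with \<open>k < N\<close>. As \<open>L + N (N + 1)\<close> acts on \<open>f\<^sub>k\<close> as a non-zero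
  scalar, subtracting rescaled \<open>f\<^sub>k\<close> from \<open>p\<close> leaves an element of its kernel, which is the component
  of index \<open>N\<close>.\<close>

lemma ex_eigen_family:
  "degree p \<le> n \<Longrightarrow> \<exists>e. eigen_family e \<and> p = (\<Sum>k\<le>n. e k)"
proof (induction n arbitrary: p)
  case 0
  have "jacobi p = 0"
    using 0 pderiv_eq_0_iff[of p] by (simp add: jacobi_def)
  then have "eigen_family (\<lambda>k. if k = 0 then p else 0)"
    by (auto simp: eigen_family_def)
  then show ?case by (intro exI[of _ "\<lambda>k. if k = 0 then p else 0"]) auto
next
  case (Suc n)
  define \<Lambda> where "\<Lambda> = eigenvalue (Suc n)"
  define r where "r = jacobi p + smult \<Lambda> p"
  have "coeff r i = 0" if "i > n" for i
  proof (cases "i = Suc n")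
    case True
    then have "coeff p (i + 2) = 0" using Suc.prems by (intro coeff_eq_0) auto
    then show ?thesis using True by (simp add: r_def coeff_jacobi \<Lambda>_def algebra_simps)
  next
    case False
    then have "coeff p (i + 2) = 0" "coeff p i = 0"
      using Suc.prems that by (auto intro!: coeff_eq_0)
    then show ?thesis by (simp add: r_def coeff_jacobi)
  qed
  then have "degree r \<le> n" by (intro degree_le) auto
  with Suc.IH obtain f where f: "eigen_family f" "r = (\<Sum>k\<le>n. f k)" by blast
  define g where "g k = smult (1 / (\<Lambda> - eigenvalue k)) (f k)" for k
  define e where "e k = (if k \<le> n then g k else if k = Suc n then p - (\<Sum>k\<le>n. g k) else 0)" for k
  have g: "jacobi (g k) = smult (- eigenvalue k) (g k)" for k
    using f(1) by (simp add: g_def jacobi_smult eigen_family_def)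
  have gf: "smult (\<Lambda> - eigenvalue k) (g k) = f k" if "k \<le> n" for k
    using that eigenvalue_inject[of "Suc n" k] by (simp add: g_def \<Lambda>_def del: of_nat_Suc)
  have "jacobi (p - (\<Sum>k\<le>n. g k)) + smult \<Lambda> (p - (\<Sum>k\<le>n. g k))
      = r - (\<Sum>k\<le>n. smult (\<Lambda> - eigenvalue k) (g k))"
    by (simp add: r_def jacobi_diff jacobi_sum g smult_diff_right smult_diff_left smult_sum_right
        sum_subtractf sum.distrib sum_negf)
  also have "\<dots> = 0" using f(2) gf by simp
  finally have "jacobi (p - (\<Sum>k\<le>n. g k)) = smult (- \<Lambda>) (p - (\<Sum>k\<le>n. g k))"
    by (simp add: add_eq_0_iff2)
  then have "eigen_family e"
    by (auto simp: eigen_family_def e_def g \<Lambda>_def)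
  moreover have "p = (\<Sum>k\<le>Suc n. e k)" by (simp add: e_def)
  ultimately show ?case by blast
qed

text \<open>The weight \<open>1 - x\<^sup>2\<close> vanishes at both endpoints, so integration by parts has no boundary terms.\<close>

lemma integral_divergence_eq_0:
  assumes "\<And>x. x \<in> E \<Longrightarrow> ((\<lambda>x. (1 - x\<^sup>2) * g x) has_real_derivative F x) (at x within E)"
  shows "(F has_integral 0) E"
proof -
  have "(F has_integral ((1 - 1\<^sup>2) * g 1 - (1 - (-1)\<^sup>2) * g (-1))) E"
    by (rule fundamental_theorem_of_calculus)
      (use assms in \<open>auto simp: has_real_derivative_iff_has_vector_derivative\<close>)
  then show ?thesis by simp
qed

definition pairing :: "real poly \<Rightarrow> real poly \<Rightarrow> real" where
  "pairing p q = integral E (\<lambda>x. poly p x * poly q x)"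

text \<open>\<open>L p q - p L q\<close> is the derivative of \<open>(1 - x\<^sup>2) (p' q - p q')\<close>.\<close>

lemma pairing_jacobi: "pairing (jacobi p) q = pairing p (jacobi q)"
proof -
  have "((\<lambda>x. poly (jacobi p) x * poly q x - poly p x * poly (jacobi q) x) has_integral 0) E"
    by (rule integral_divergence_eq_0[where g = "\<lambda>x. poly (pderiv p) x * poly q x - poly p x * poly (pderiv q) x"])
      (auto intro!: derivative_eq_intros simp: poly_jacobi algebra_simps power2_eq_square)
  moreover have "(\<lambda>x. poly p' x * poly q' x) integrable_on E" for p' q'
    by (intro integrable_continuous_interval continuous_intros)
  ultimately show ?thesis
    by (auto simp: pairing_def dest!: integral_unique simp: Henstock_Kurzweil_Integration.integral_diff)
qed

lemma pairing_smult: "pairing (smult c p) q = c * pairing p q" "pairing p (smult c q) = c * pairing p q"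
  by (simp_all add: pairing_def mult_ac flip: integral_mult_right)

lemma pairing_commute: "pairing p q = pairing q p"
  by (simp add: pairing_def mult.commute)

lemma pairing_0 [simp]: "pairing 0 q = 0" "pairing p 0 = 0"
  by (simp_all add: pairing_def)

lemma pairing_add: "pairing (p + p') q = pairing p q + pairing p' q"
  unfolding pairing_def poly_add distrib_right
  by (intro Henstock_Kurzweil_Integration.integral_add integrable_continuous_interval continuous_intros)

lemma pairing_sum_left: "pairing (sum f A) q = (\<Sum>x\<in>A. pairing (f x) q)"
  by (induction A rule: infinite_finite_induct) (auto simp: pairing_add)

lemma pairing_sum_right: "pairing q (sum f A) = (\<Sum>x\<in>A. pairing q (f x))"
  by (subst (1 2) pairing_commute) (rule pairing_sum_left)

lemma pairing_self_eq_0: "pairing p p = 0 \<longleftrightarrow> p = 0"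
proof
  assume "pairing p p = 0"
  then have "\<forall>x\<in>{-1..1}. poly p x * poly p x = 0"
    unfolding pairing_def
    by (subst integral_eq_0_iff[symmetric]) (auto intro!: continuous_intros)
  then have "{-1..1} \<subseteq> {x. poly p x = 0}" by auto
  moreover have "infinite {-1..1::real}" by simp
  ultimately show "p = 0" using poly_roots_finite finite_subset by blast
qed simp

lemma eigen_orthogonal:
  assumes "eigen_family e" "eigen_family f" "j \<noteq> k"
  shows "pairing (e j) (f k) = 0"
proof -
  have "eigenvalue j * pairing (e j) (f k) = eigenvalue k * pairing (e j) (f k)"
    using pairing_jacobi[of "e j" "f k"] assms(1,2)[unfolded eigen_family_def, rule_format]
    by (simp only: pairing_smult) simp
  then show ?thesis using eigenvalue_inject[of j k] assms by simp
qed

text \<open>The difference of the two families is a family summing to \<open>0\<close>; pairing this sum with one of its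
  components leaves only the square of that component.\<close>

lemma eigen_sum_unique:
  assumes "eigen_family e" "eigen_family f" "(\<Sum>k\<le>n. e k) = (\<Sum>k\<le>n. f k)" "j \<le> n"
  shows "e j = f j"
proof -
  define d where "d k = e k - f k" for k
  have d: "eigen_family d"
    using assms by (simp add: eigen_family_def d_def jacobi_diff smult_diff_right)
  have "0 = pairing (d j) (\<Sum>k\<le>n. d k)"
    using assms by (simp add: d_def sum_subtractf)
  also have "\<dots> = (\<Sum>k\<le>n. if k = j then pairing (d j) (d j) else 0)"
    unfolding pairing_sum_right using eigen_orthogonal[OF d d, of j] by (intro sum.cong) auto
  finally have "pairing (d j) (d j) = 0" using assms by simp
  then show ?thesis by (simp add: pairing_self_eq_0 d_def)
qed

section \<open>The heat semigroup\<close>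

definition heat :: "real \<Rightarrow> real poly \<Rightarrow> real poly" where
  "heat t p = (\<Sum>k\<le>degree p. smult (exp (- eigenvalue k * t))
     ((SOME e. eigen_family e \<and> p = (\<Sum>k\<le>degree p. e k)) k))"

text \<open>Every decomposition gives the same semigroup, by uniqueness of the components. Both families are
  padded with zeros to a common length, to cover the case that \<open>m\<close> differs from the degree.\<close>

lemma heat_eigen_sum:
  assumes "eigen_family f" "p = (\<Sum>k\<le>m. f k)"
  shows "heat t p = (\<Sum>k\<le>m. smult (exp (- eigenvalue k * t)) (f k))"
proof -
  let ?n = "degree p"
  define e where "e = (SOME e. eigen_family e \<and> p = (\<Sum>k\<le>degree p. e k))"
  have e: "eigen_family e" "p = (\<Sum>k\<le>degree p. e k)"
    using someI_ex[OF ex_eigen_family[OF order_refl, of p]] by (simp_all add: e_def)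
  define cut where "cut g l k = (if k \<le> l then g k else (0::real poly))" for g and l k :: nat
  have cut: "eigen_family (cut g l)" if "eigen_family g" for g l
    using that by (simp add: eigen_family_def cut_def)
  have cut_sum: "(\<Sum>k\<le>max m ?n. smult (c k) (cut g l k)) = (\<Sum>k\<le>l. smult (c k) (g k))"
    if "l \<le> max m ?n" for c g l
    using that by (intro sum.mono_neutral_cong_right) (auto simp: cut_def)
  have "(\<Sum>k\<le>max m ?n. cut e ?n k) = (\<Sum>k\<le>max m ?n. cut f m k)"
    using cut_sum[of ?n "\<lambda>_. 1" e] cut_sum[of m "\<lambda>_. 1" f] e(2) assms(2) by simp
  then have eq: "cut e ?n k = cut f m k" if "k \<le> max m ?n" for k
    using eigen_sum_unique[OF cut[OF e(1)] cut[OF assms(1)]] that by blast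
  have "heat t p = (\<Sum>k\<le>?n. smult (exp (- eigenvalue k * t)) (e k))"
    by (simp add: heat_def e_def)
  also have "\<dots> = (\<Sum>k\<le>max m ?n. smult (exp (- eigenvalue k * t)) (cut f m k))"
    by (subst cut_sum[of ?n, symmetric]) (auto simp: eq)
  finally show ?thesis by (simp add: cut_sum)
qed

lemma eigen_expansion:
  obtains e n where "eigen_family e" "p = (\<Sum>k\<le>n. e k)"
    "\<And>t. heat t p = (\<Sum>k\<le>n. smult (exp (- eigenvalue k * t)) (e k))"
  using ex_eigen_family[OF order_refl, of p] heat_eigen_sum by metis

lemma heat_0 [simp]: "heat 0 p = p"
  by (rule eigen_expansion[of p]) simp

lemma heat_jacobi: "heat t (jacobi p) = jacobi (heat t p)"
proof (rule eigen_expansion[of p])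
  fix e n assume e: "eigen_family e" "p = (\<Sum>k\<le>n. e k)"
    and t: "\<And>t. heat t p = (\<Sum>k\<le>n. smult (exp (- eigenvalue k * t)) (e k))"
  have "eigen_family (\<lambda>k. jacobi (e k))"
    using e(1) by (metis eigen_family_def jacobi_smult)
  then show ?thesis
    unfolding t by (subst heat_eigen_sum) (auto simp: e(2) jacobi_sum jacobi_smult)
qed

lemma heat_const [simp]: "heat t [:c:] = [:c:]"
proof -
  have "eigen_family (\<lambda>k. if k = 0 then [:c:] else 0)"
    by (simp add: eigen_family_def jacobi_def)
  then show ?thesis by (subst heat_eigen_sum[where m = 0]) auto
qed

lemma heat_smult: "heat t (smult c p) = smult c (heat t p)"
proof (rule eigen_expansion[of p])
  fix e n assume e: "eigen_family e" "p = (\<Sum>k\<le>n. e k)"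
    and t: "\<And>t. heat t p = (\<Sum>k\<le>n. smult (exp (- eigenvalue k * t)) (e k))"
  have "eigen_family (\<lambda>k. smult c (e k))"
    using e(1) by (simp add: eigen_family_def jacobi_smult mult.commute)
  then show ?thesis
    unfolding t by (subst heat_eigen_sum) (auto simp: e(2) smult_sum_right mult.commute)
qed

lemma heat_diff: "heat t (p - q) = heat t p - heat t q"
proof -
  obtain e where e: "eigen_family e" "p = (\<Sum>k\<le>max (degree p) (degree q). e k)"
    using ex_eigen_family[OF max.cobounded1] by blast
  obtain f where f: "eigen_family f" "q = (\<Sum>k\<le>max (degree p) (degree q). f k)"
    using ex_eigen_family[OF max.cobounded2] by blast
  have d: "eigen_family (\<lambda>k. e k - f k)"
    using e(1) f(1) by (simp add: eigen_family_def jacobi_diff smult_diff_right)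
  have "p - q = (\<Sum>k\<le>max (degree p) (degree q). e k - f k)"
    by (subst e(2), subst f(2)) (simp add: sum_subtractf)
  from heat_eigen_sum[OF d this] heat_eigen_sum[OF e] heat_eigen_sum[OF f] show ?thesis
    by (simp add: sum_subtractf smult_diff_right)
qed

text \<open>Components of different index are orthogonal, so only the terms with \<open>j = k\<close> survive, and these
  carry the same exponential on both sides.\<close>

lemma heat_adjoint: "pairing (heat t p) q = pairing p (heat t q)"
proof (rule eigen_expansion[of p])
  fix e n assume e: "eigen_family e" "p = (\<Sum>k\<le>n. e k)"
    and et: "\<And>t. heat t p = (\<Sum>k\<le>n. smult (exp (- eigenvalue k * t)) (e k))"
  show ?thesis
  proof (rule eigen_expansion[of q])
    fix f m assume f: "eigen_family f" "q = (\<Sum>k\<le>m. f k)"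
      and ft: "\<And>t. heat t q = (\<Sum>k\<le>m. smult (exp (- eigenvalue k * t)) (f k))"
    have "exp (- eigenvalue j * t) * pairing (e j) (f k) = exp (- eigenvalue k * t) * pairing (e j) (f k)" for j k
      using eigen_orthogonal[OF e(1) f(1), of j k] by (cases "j = k") auto
    then show ?thesis
      unfolding et ft unfolding e(2) f(2) pairing_sum_left pairing_sum_right pairing_smult sum_distrib_left
      by (intro sum.cong refl)
  qed
qed

lemma has_derivative_heat:
  "((\<lambda>t. poly ((pderiv ^^ j) (heat t p)) x) has_real_derivative
     poly ((pderiv ^^ j) (jacobi (heat t p))) x) (at t within T)"
proof (rule eigen_expansion[of p])
  fix e n assume e: "eigen_family e" "p = (\<Sum>k\<le>n. e k)"
    and t: "\<And>t. heat t p = (\<Sum>k\<le>n. smult (exp (- eigenvalue k * t)) (e k))"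
  show ?thesis
    unfolding t jacobi_sum higher_pderiv_sum jacobi_smult e(1)[unfolded eigen_family_def, rule_format]
      higher_pderiv_smult poly_sum poly_smult
    by (auto intro!: derivative_eq_intros sum.cong)
qed

lemma continuous_on_heat:
  assumes [continuous_intros]: "continuous_on S f" "continuous_on S g"
  shows "continuous_on S (\<lambda>z. poly ((pderiv ^^ j) (heat (f z) p)) (g z))"
proof (rule eigen_expansion[of p])
  fix e n assume e: "eigen_family e" "p = (\<Sum>k\<le>n. e k)"
    and t: "\<And>t. heat t p = (\<Sum>k\<le>n. smult (exp (- eigenvalue k * t)) (e k))"
  show ?thesis
    unfolding t higher_pderiv_sum higher_pderiv_smult poly_sum poly_smult
    by (intro continuous_intros)
qed

section \<open>The maximum principle and pointwise bounds\<close>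

text \<open>Add \<open>\<eta> t\<close> to \<open>u\<close> and look at a minimum over the compact space-time cylinder. At positive time
  the time derivative of \<open>u + \<eta> t\<close> is at most \<open>0\<close> there, whereas \<open>L u \<ge> 0\<close>: in the interior because
  \<open>u' = 0\<close> and \<open>u'' \<ge> 0\<close>, and at \<open>x = 1\<close> or \<open>x = -1\<close> because \<open>L u = - 2 x u'\<close> and the one-sided
  minimum fixes the sign of \<open>u'\<close>. For \<open>\<eta> > 0\<close> the two contradict
  each other, so the minimum lies at time \<open>0\<close>.\<close>

lemma max_principle:
  fixes u ut ux uxx :: "real \<Rightarrow> real \<Rightarrow> real"
  assumes cont: "continuous_on ({0..T} \<times> E) (\<lambda>(t, x). u t x)"
    and ut: "\<And>t x. t \<in> {0..T} \<Longrightarrow> x \<in> E \<Longrightarrow> ((\<lambda>t. u t x) has_real_derivative ut t x) (at t)"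
    and ux: "\<And>t x. t \<in> {0..T} \<Longrightarrow> x \<in> E \<Longrightarrow> (u t has_real_derivative ux t x) (at x)"
    and uxx: "\<And>t x. t \<in> {0..T} \<Longrightarrow> x \<in> E \<Longrightarrow> (ux t has_real_derivative uxx t x) (at x)"
    and super: "\<And>t x. t \<in> {0..T} \<Longrightarrow> x \<in> E \<Longrightarrow> (1 - x\<^sup>2) * uxx t x - 2 * x * ux t x \<le> ut t x"
    and init: "\<And>x. x \<in> E \<Longrightarrow> 0 \<le> u 0 x"
    and tx: "t \<in> {0..T}" "x \<in> E"
  shows "0 \<le> u t x"
proof (rule field_le_epsilon)
  fix \<epsilon> :: real assume "0 < \<epsilon>"
  \<comment> \<open>The drift \<open>\<eta> t\<close> stays below \<open>\<epsilon>\<close> up to time \<open>T\<close>.\<close>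
  define \<eta> where "\<eta> = \<epsilon> / (T + 1)"
  have T: "0 \<le> T" using tx by simp
  have \<eta>: "0 < \<eta>" using \<open>0 < \<epsilon>\<close> T by (simp add: \<eta>_def)
  define w where "w = (\<lambda>(t, x). u t x + \<eta> * t)"
  have "continuous_on ({0..T} \<times> E) w"
    unfolding w_def using cont by (auto simp: case_prod_unfold intro!: continuous_intros)
  moreover have "compact ({0..T} \<times> E)" "{0..T} \<times> E \<noteq> {}"
    using tx by (auto intro: compact_Times)
  ultimately obtain z where "z \<in> {0..T} \<times> E" "\<And>y. y \<in> {0..T} \<times> E \<Longrightarrow> w z \<le> w y"
    using continuous_attains_inf[of "{0..T} \<times> E" w] by blast
  then obtain s y where s: "s \<in> {0..T}" and y: "y \<in> E"
    and least: "\<And>s' y'. s' \<in> {0..T} \<Longrightarrow> y' \<in> E \<Longrightarrow> u s y + \<eta> * s \<le> u s' y' + \<eta> * s'"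
    by (cases z) (auto simp: w_def)
  have least_x: "u s y \<le> u s y'" if "y' \<in> E" for y'
    using least[OF s that] by simp
  have "0 \<le> u s y + \<eta> * s"
  proof (cases "s = 0")
    case True
    then show ?thesis using init[OF y] by simp
  next
    case False
    then have "0 < s" using s by simp
    have dw: "((\<lambda>t. u t y + \<eta> * t) has_real_derivative ut s y + \<eta>) (at s)"
      by (auto intro!: derivative_eq_intros ut s y)
    have "ut s y + \<eta> \<le> 0"
    proof (rule ccontr)
      assume "\<not> ut s y + \<eta> \<le> 0"
      then obtain d where d: "d > 0" "\<And>h. 0 < h \<Longrightarrow> h < d \<Longrightarrow> u (s - h) y + \<eta> * (s - h) < u s y + \<eta> * s"
        using DERIV_pos_inc_left[OF dw] by force
      define h where "h = min (d / 2) s"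
      have "0 < h" "h < d" "s - h \<in> {0..T}" using d(1) \<open>0 < s\<close> s by (auto simp: h_def)
      then show False using d(2)[of h] least[of "s - h" y] y by simp
    qed
    moreover have right: "0 \<le> ux s y" if "y < 1"
    proof (rule ccontr)
      assume "\<not> 0 \<le> ux s y"
      then obtain d where d: "d > 0" "\<And>h. 0 < h \<Longrightarrow> h < d \<Longrightarrow> u s (y + h) < u s y"
        using DERIV_neg_dec_right[OF ux[OF s y]] by force
      define h where "h = min (d / 2) (1 - y)"
      have "0 < h" "h < d" "y + h \<in> E" using d(1) that y by (auto simp: h_def)
      then show False using d(2)[of h] least_x[of "y + h"] by simp
    qed
    have left: "ux s y \<le> 0" if "-1 < y"
    proof (rule ccontr)
      assume "\<not> ux s y \<le> 0"
      then obtain d where d: "d > 0" "\<And>h. 0 < h \<Longrightarrow> h < d \<Longrightarrow> u s (y - h) < u s y"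
        using DERIV_pos_inc_left[OF ux[OF s y]] by force
      define h where "h = min (d / 2) (y + 1)"
      have "0 < h" "h < d" "y - h \<in> E" using d(1) that y by (auto simp: h_def)
      then show False using d(2)[of h] least_x[of "y - h"] by simp
    qed
    have second: "0 \<le> uxx s y" if "-1 < y" "y < 1"
    proof (rule ccontr)
      assume "\<not> 0 \<le> uxx s y"
      then obtain d where d: "d > 0" "\<And>h. 0 < h \<Longrightarrow> h < d \<Longrightarrow> ux s (y + h) < ux s y"
        using DERIV_neg_dec_right[OF uxx[OF s y]] by force
      define h where "h = min (d / 2) (1 - y)"
      have h: "0 < h" "h < d" "y + h \<in> E" using d(1) that y by (auto simp: h_def)
      have "\<exists>z>y. z < y + h \<and> u s (y + h) - u s y = (y + h - y) * ux s z"
        by (rule MVT2) (use h y in \<open>auto intro!: ux s\<close>)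
      then obtain z where z: "y < z" "z < y + h" "u s (y + h) - u s y = h * ux s z" by auto
      have "ux s z < ux s y" using d(2)[of "z - y"] z h by simp
      also have "\<dots> = 0" using left right that by simp
      finally have "h * ux s z < 0" using h by (simp add: mult_pos_neg)
      then show False using z least_x[OF h(3)] by simp
    qed
    have "0 \<le> (1 - y\<^sup>2) * uxx s y - 2 * y * ux s y"
    proof -
      consider "y = 1" | "y = -1" | "-1 < y" "y < 1" using y by force
      then show ?thesis
      proof cases
        case 3
        then have "ux s y = 0" "0 \<le> uxx s y" "0 \<le> 1 - y\<^sup>2"
          using left right second by (auto simp: abs_square_le_1 abs_le_iff)
        then show ?thesis by simp
      qed (use left right in auto)
    qed
    with super[OF s y] have "0 \<le> ut s y" by simp
    ultimately show ?thesis using \<eta> by simp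
  qed
  also have "\<dots> \<le> u t x + \<eta> * t" using least[OF tx] .
  also have "\<eta> * t \<le> \<epsilon>"
  proof -
    have "\<epsilon> * t \<le> \<epsilon> * (T + 1)" using tx \<open>0 < \<epsilon>\<close> by (intro mult_left_mono) auto
    then show ?thesis using T by (simp add: \<eta>_def divide_le_eq)
  qed
  finally show "0 \<le> u t x + \<epsilon>" by simp
qed


lemma heat_derivs:
  shows "((\<lambda>t. poly (heat t p) x) has_real_derivative poly (jacobi (heat t p)) x) (at t within T)"
    and "((\<lambda>t. poly (pderiv (heat t p)) x) has_real_derivative poly (pderiv (jacobi (heat t p))) x) (at t within T)"
    and "((\<lambda>t. poly (pderiv (pderiv (heat t p))) x) has_real_derivative
           poly (pderiv (pderiv (jacobi (heat t p)))) x) (at t within T)"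
  using has_derivative_heat[of 0 p x t T] has_derivative_heat[of 1 p x t T]
    has_derivative_heat[of 2 p x t T] by (simp_all add: numeral_2_eq_2)

lemma continuous_on_heats [continuous_intros]:
  assumes "continuous_on S f" "continuous_on S g"
  shows "continuous_on S (\<lambda>z. poly (heat (f z) p) (g z))"
    and "continuous_on S (\<lambda>z. poly (pderiv (heat (f z) p)) (g z))"
    and "continuous_on S (\<lambda>z. poly (pderiv (pderiv (heat (f z) p))) (g z))"
    and "continuous_on S (\<lambda>z. poly (pderiv (pderiv (pderiv (heat (f z) p)))) (g z))"
  using continuous_on_heat[OF assms, of 0 p] continuous_on_heat[OF assms, of 1 p]
    continuous_on_heat[OF assms, of 2 p] continuous_on_heat[OF assms, of 3 p]
  by (simp_all add: numeral_2_eq_2 numeral_3_eq_3)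

lemma heat_nonneg:
  assumes "\<And>x. x \<in> E \<Longrightarrow> 0 \<le> poly p x" "0 \<le> t" "x \<in> E"
  shows "0 \<le> poly (heat t p) x"
proof (rule max_principle[where u = "\<lambda>t x. poly (heat t p) x" and T = t])
  show "continuous_on ({0..t} \<times> E) (\<lambda>(t, x). poly (heat t p) x)"
    unfolding case_prod_unfold by (intro continuous_intros)
qed (use assms in \<open>auto intro: heat_derivs poly_DERIV simp: poly_jacobi\<close>)

lemma heat_le:
  assumes "\<And>x. x \<in> E \<Longrightarrow> poly p x \<le> c" "0 \<le> t" "x \<in> E"
  shows "poly (heat t p) x \<le> c"
  using heat_nonneg[of "[:c:] - p" t x] assms by (simp add: heat_diff del: diff_pCons)

lemma heat_ge:
  assumes "\<And>x. x \<in> E \<Longrightarrow> c \<le> poly p x" "0 \<le> t" "x \<in> E"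
  shows "c \<le> poly (heat t p) x"
  using heat_nonneg[of "p - [:c:]" t x] assms by (simp add: heat_diff del: diff_pCons)

lemma heat_abs_le:
  assumes "\<And>x. x \<in> E \<Longrightarrow> \<bar>poly p x\<bar> \<le> c" "0 \<le> t" "x \<in> E"
  shows "\<bar>poly (heat t p) x\<bar> \<le> c"
  using heat_le[of p c t x] heat_ge[of "-c" p t x] assms by (force simp: abs_le_iff)

lemma one_minus_square_nonneg: "x \<in> E \<Longrightarrow> 0 \<le> 1 - x\<^sup>2" for x :: real
  by (auto simp: abs_square_le_1 abs_le_iff)

definition carre_du_champ :: "real poly \<Rightarrow> real poly" where
  "carre_du_champ p = [:1, 0, -1:] * (pderiv p)\<^sup>2"

lemma poly_carre_du_champ: "poly (carre_du_champ p) x = (1 - x\<^sup>2) * (poly (pderiv p) x)\<^sup>2"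
  by (simp add: carre_du_champ_def power2_eq_square algebra_simps)

text \<open>The regularisation estimate behind the large-time bound. Let \<open>f = P\<^sub>t p\<close>. In one dimension
  \<open>\<Gamma>\<^sub>2 f = (a f'' - x f')\<^sup>2 + f'\<^sup>2\<close>, so \<open>2 \<Gamma>\<^sub>2 f - 2 \<Gamma> f - (a f'')\<^sup>2\<close> is the square
  \<open>(a f'' - 2 x f')\<^sup>2\<close>, and \<open>(a f'')\<^sup>2\<close> is a subsolution of the heat equation. Therefore
  \<open>P\<^sub>t (\<Gamma> p) - exp (2 t) \<Gamma> f - \<alpha> (a f'')\<^sup>2\<close> is a supersolution if \<open>\<alpha>' = exp (2 t)\<close>. It vanishes
  at time \<open>0\<close> if \<open>\<alpha> = (exp (2 t) - 1) / 2\<close>. Both terms on the left are used: the first bounds the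
  gradient, the second the Hessian.\<close>

lemma heat_gradient_hessian_bound:
  assumes "0 \<le> t" "x \<in> E"
  shows "exp (2 * t) * ((1 - x\<^sup>2) * (poly (pderiv (heat t p)) x)\<^sup>2)
      + (exp (2 * t) - 1) / 2 * ((1 - x\<^sup>2) * poly (pderiv (pderiv (heat t p))) x)\<^sup>2
    \<le> poly (heat t (carre_du_champ p)) x"
proof -
  define G where "G = carre_du_champ p"
  define f1 where "f1 t = pderiv (heat t p)" for t
  define u where "u t x = poly (heat t G) x - exp (2 * t) * ((1 - x\<^sup>2) * (poly (f1 t) x)\<^sup>2)
      - (exp (2 * t) - 1) / 2 * ((1 - x\<^sup>2) * poly (pderiv (f1 t)) x)\<^sup>2" for t x
  define ut where "ut t x = poly (jacobi (heat t G)) x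
      - 2 * exp (2 * t) * ((1 - x\<^sup>2) * (poly (f1 t) x)\<^sup>2)
      - exp (2 * t) * ((1 - x\<^sup>2) * (2 * poly (f1 t) x * poly (pderiv (jacobi (heat t p))) x))
      - exp (2 * t) * ((1 - x\<^sup>2) * poly (pderiv (f1 t)) x)\<^sup>2
      - (exp (2 * t) - 1) * ((1 - x\<^sup>2)\<^sup>2 * (poly (pderiv (f1 t)) x * poly (pderiv (pderiv (jacobi (heat t p)))) x))" for t x
  define U where "U t = heat t G - smult (exp (2 * t)) ([:1, 0, -1:] * (f1 t)\<^sup>2)
     - smult ((exp (2 * t) - 1) / 2) (([:1, 0, -1:] * pderiv (f1 t))\<^sup>2)" for t
  have uU: "u t = poly (U t)" for t
    by (rule ext) (simp add: u_def U_def power2_eq_square algebra_simps)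
  have "0 \<le> u t x"
  proof (rule max_principle[where u = u and t = t and x = x and T = t and ut = ut and ux = "\<lambda>t. poly (pderiv (U t))" and
        uxx = "\<lambda>t. poly (pderiv (pderiv (U t)))"])
    show "continuous_on ({0..t} \<times> E) (\<lambda>(t, x). u t x)"
      unfolding case_prod_unfold u_def f1_def by (intro continuous_intros) auto
  next
    fix t x :: real
    show "((\<lambda>t. u t x) has_real_derivative ut t x) (at t)"
      unfolding u_def f1_def
      by (auto intro!: derivative_eq_intros heat_derivs simp: ut_def f1_def power2_eq_square field_simps)
    show "(u t has_real_derivative poly (pderiv (U t)) x) (at x)"
      unfolding uU by (rule poly_DERIV)
    show "(poly (pderiv (U t)) has_real_derivative poly (pderiv (pderiv (U t))) x) (at x)"
      by (rule poly_DERIV)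
  next
    fix s y assume s: "s \<in> {0..t}" and y: "y \<in> E"
    define g1 g2 g3 where "g1 = poly (f1 s) y" and "g2 = poly (pderiv (f1 s)) y"
      and "g3 = poly (pderiv (pderiv (f1 s))) y"
    define g4 where "g4 = poly (pderiv (pderiv (pderiv (f1 s)))) y"
    note g = g1_def[symmetric] g2_def[symmetric] g3_def[symmetric] g4_def[symmetric]
    define e where "e = exp (2 * s)"
    define \<alpha> where "\<alpha> = (e - 1) / 2"
    note p = pderiv_add pderiv_diff pderiv_smult pderiv_minus pderiv_mult pderiv_pCons power2_eq_square
    have U1: "poly (pderiv (U s)) y = poly (pderiv (heat s G)) y
       - e * (2 * (1 - y\<^sup>2) * g1 * g2 - 2 * y * g1\<^sup>2)
       - \<alpha> * (2 * (1 - y\<^sup>2)\<^sup>2 * g2 * g3 - 4 * y * (1 - y\<^sup>2) * g2\<^sup>2)"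
      unfolding U_def e_def[symmetric] \<alpha>_def[symmetric]
      by (simp add: p g del: mult_pCons_left) algebra
    have U2: "poly (pderiv (pderiv (U s))) y = poly (pderiv (pderiv (heat s G))) y
       - e * (2 * (1 - y\<^sup>2) * (g2\<^sup>2 + g1 * g3) - 8 * y * g1 * g2 - 2 * g1\<^sup>2)
       - \<alpha> * (2 * (1 - y\<^sup>2)\<^sup>2 * (g3\<^sup>2 + g2 * g4) - 16 * y * (1 - y\<^sup>2) * g2 * g3
           + (8 * y\<^sup>2 - 4 * (1 - y\<^sup>2)) * g2\<^sup>2)"
      unfolding U_def e_def[symmetric] \<alpha>_def[symmetric]
      by (simp add: p g del: mult_pCons_left) algebra
    have e1: "e - 1 = 2 * \<alpha>" by (simp add: \<alpha>_def)
    have ut: "ut s y = (1 - y\<^sup>2) * poly (pderiv (pderiv (heat s G))) y - 2 * y * poly (pderiv (heat s G)) y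
        - 2 * e * ((1 - y\<^sup>2) * g1\<^sup>2)
        - e * ((1 - y\<^sup>2) * (2 * g1 * ((1 - y\<^sup>2) * g3 - 4 * y * g2 - 2 * g1)))
        - e * ((1 - y\<^sup>2) * g2)\<^sup>2
        - 2 * \<alpha> * ((1 - y\<^sup>2)\<^sup>2 * (g2 * ((1 - y\<^sup>2) * g4 - 6 * y * g3 - 6 * g2)))"
      unfolding ut_def poly_pderiv_jacobi poly_pderiv_pderiv_jacobi poly_jacobi e_def[symmetric]
        f1_def[symmetric] g e1 by simp
    \<comment> \<open>The residual of the heat equation as a sum of non-negative terms.\<close>
    have "ut s y - ((1 - y\<^sup>2) * poly (pderiv (pderiv (U s))) y - 2 * y * poly (pderiv (U s)) y)
      = e * ((1 - y\<^sup>2) * g2 - 2 * y * g1)\<^sup>2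
        + \<alpha> * (2 * (1 - y\<^sup>2) * ((1 - y\<^sup>2) * g3 - 2 * y * g2)\<^sup>2 + 8 * (1 - y\<^sup>2) * g2\<^sup>2)"
      unfolding ut U1 U2 by algebra
    moreover have "0 \<le> \<alpha>" using s by (simp add: \<alpha>_def e_def)
    ultimately show "(1 - y\<^sup>2) * poly (pderiv (pderiv (U s))) y - 2 * y * poly (pderiv (U s)) y \<le> ut s y"
      using one_minus_square_nonneg[OF y]
      by (smt (verit) add_nonneg_nonneg mult_nonneg_nonneg zero_le_power2 e_def exp_ge_zero)
  qed (use assms in \<open>auto simp: u_def G_def f1_def poly_carre_du_champ\<close>)
  then show ?thesis by (simp add: u_def f1_def G_def)
qed


section \<open>Dissipation of entropy and Fisher information\<close>

lemma at_within_Ici: "0 < t \<Longrightarrow> at t within {0..} = at t" for t :: real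
  by (rule at_within_interior) (simp add: interior_real_atLeast)

text \<open>Along the flow only one-sided derivatives are available at time \<open>0\<close>, since positivity is not
  preserved for negative times.\<close>

lemma nondecreasing_within_Ici:
  fixes f :: "real \<Rightarrow> real"
  assumes "0 \<le> a" "a \<le> b"
    and f: "\<And>s. a \<le> s \<Longrightarrow> s \<le> b \<Longrightarrow> (f has_real_derivative f' s) (at s within {0..})"
    and f': "\<And>s. a \<le> s \<Longrightarrow> s \<le> b \<Longrightarrow> 0 \<le> f' s"
  shows "f a \<le> f b"
proof (rule DERIV_nonneg_imp_increasing_open[OF \<open>a \<le> b\<close>])
  show "\<exists>y. (f has_real_derivative y) (at x) \<and> 0 \<le> y" if "a < x" "x < b" for x
    using f[of x] f'[of x] that \<open>0 \<le> a\<close> at_within_Ici[of x] by auto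
  show "continuous_on {a..b} f"
  proof (rule DERIV_continuous_on[where D = f'])
    show "(f has_real_derivative f' x) (at x within {a..b})" if "x \<in> {a..b}" for x
      by (rule DERIV_subset[OF f]) (use that \<open>0 \<le> a\<close> in auto)
  qed
qed

text \<open>For a density \<open>\<psi>\<close> with flux \<open>a g\<close>, the part \<open>(a g)'\<close> of the time derivative integrates to \<open>0\<close>.
  This reduces both dissipation formulas to pointwise identities.\<close>

lemma heat_dissipation:
  fixes \<psi> \<psi>t g F :: "real \<Rightarrow> real \<Rightarrow> real"
  assumes \<psi>t: "\<And>t x. 0 \<le> t \<Longrightarrow> x \<in> E \<Longrightarrow> ((\<lambda>t. \<psi> t x) has_real_derivative \<psi>t t x) (at t within {0..})"
    and flux: "\<And>t x. 0 \<le> t \<Longrightarrow> x \<in> E \<Longrightarrow> ((\<lambda>x. (1 - x\<^sup>2) * g t x) has_real_derivative F t x) (at x within E)"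
    and cont: "\<And>t. 0 \<le> t \<Longrightarrow> continuous_on E (\<psi> t)" "continuous_on ({0..} \<times> E) (\<lambda>(t, x). \<psi>t t x)"
    and t: "0 \<le> t"
  shows "((\<lambda>t. integral E (\<psi> t)) has_real_derivative integral E (\<lambda>x. \<psi>t t x - F t x)) (at t within {0..})"
proof -
  have "((\<lambda>t. integral (cbox (-1) 1) (\<psi> t)) has_real_derivative integral (cbox (-1) 1) (\<psi>t t)) (at t within {0..})"
    by (rule leibniz_rule_field_derivative[where U = "{0..}"])
      (simp_all add: cbox_interval \<psi>t cont t integrable_continuous_interval)
  moreover have "(F t has_integral 0) E"
    by (rule integral_divergence_eq_0[where g = "g t"]) (rule flux[OF t])
  moreover have "continuous_on E (\<psi>t t)"
    using t by (intro continuous_on_compose2[OF cont(2), where f = "\<lambda>x. (t, x)", unfolded case_prod_conv])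
      (auto intro!: continuous_intros)
  then have "\<psi>t t integrable_on E" by (rule integrable_continuous_interval)
  ultimately show ?thesis
    using Henstock_Kurzweil_Integration.integral_diff[of "\<psi>t t" E "F t"]
    by (simp add: cbox_interval has_integral_iff)
qed

definition poly_entropy :: "real poly \<Rightarrow> real" where
  "poly_entropy p = integral E (\<lambda>x. poly p x * ln (poly p x))"

definition poly_fisher :: "real poly \<Rightarrow> real" where
  "poly_fisher p = integral E (\<lambda>x. (1 - x\<^sup>2) * (poly (pderiv p) x)\<^sup>2 / poly p x)"

lemma poly_pos_bounds:
  assumes "\<And>x. x \<in> E \<Longrightarrow> 0 < poly p x"
  shows "\<exists>m M. 0 < m \<and> (\<forall>x\<in>E. m \<le> poly p x \<and> poly p x \<le> M)"
proof -
  have "continuous_on E (poly p)" by (intro continuous_intros)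
  moreover have "compact E" "E \<noteq> {}" by auto
  ultimately obtain y z where y: "y \<in> E" "\<forall>x\<in>E. poly p y \<le> poly p x" and z: "\<forall>x\<in>E. poly p x \<le> poly p z"
    using continuous_attains_inf[of E "poly p"] continuous_attains_sup[of E "poly p"] by auto
  show ?thesis
    by (rule exI[of _ "poly p y"], rule exI[of _ "poly p z"]) (use y z assms in auto)
qed

lemma heat_pos:
  assumes "\<And>x. x \<in> E \<Longrightarrow> 0 < poly p x" "0 \<le> t" "x \<in> E"
  shows "0 < poly (heat t p) x"
proof -
  obtain m M where "0 < m" and m: "\<And>x. x \<in> E \<Longrightarrow> m \<le> poly p x" "\<And>x. x \<in> E \<Longrightarrow> poly p x \<le> M"
    using poly_pos_bounds[of p] assms(1) by blast
  then show ?thesis using heat_ge[OF m(1) assms(2,3)] by linarith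
qed

text \<open>The density \<open>Q ln Q\<close> satisfies \<open>(\<partial>\<^sub>t - L) (Q ln Q) = - \<Gamma> Q / Q\<close>.\<close>

lemma poly_entropy_deriv:
  assumes pos: "\<And>x. x \<in> E \<Longrightarrow> 0 < poly q x" and "0 \<le> t"
  shows "((\<lambda>t. poly_entropy (heat t q)) has_real_derivative - poly_fisher (heat t q)) (at t within {0..})"
proof -
  let ?Q = "\<lambda>t. heat t q"
  have Q: "poly (?Q t) x \<noteq> 0" "0 < poly (?Q t) x" if "0 \<le> t" "x \<in> E" for t x
    using heat_pos[OF pos that] by auto
  let ?\<psi>t = "\<lambda>t x. poly (jacobi (?Q t)) x * (ln (poly (?Q t) x) + 1)"
  let ?F = "\<lambda>t x. poly (jacobi (?Q t)) x * (ln (poly (?Q t) x) + 1) + (1 - x\<^sup>2) * (poly (pderiv (?Q t)) x)\<^sup>2 / poly (?Q t) x"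
  have "((\<lambda>t. poly_entropy (heat t q)) has_real_derivative integral E (\<lambda>x. ?\<psi>t t x - ?F t x)) (at t within {0..})"
    unfolding poly_entropy_def
  proof (rule heat_dissipation[where g = "\<lambda>t x. poly (pderiv (?Q t)) x * (ln (poly (?Q t) x) + 1)"])
    fix t x :: real assume tx: "0 \<le> t" "x \<in> E"
    show "((\<lambda>t. poly (?Q t) x * ln (poly (?Q t) x)) has_real_derivative ?\<psi>t t x) (at t within {0..})"
      by (rule derivative_eq_intros heat_derivs refl Q[OF tx])+ (use Q[OF tx] in \<open>simp add: field_simps\<close>)
    show "((\<lambda>x. (1 - x\<^sup>2) * (poly (pderiv (?Q t)) x * (ln (poly (?Q t) x) + 1))) has_real_derivative ?F t x) (at x within E)"
      by (rule derivative_eq_intros refl poly_DERIV[THEN DERIV_subset] subset_UNIV Q[OF tx])+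
        (use Q[OF tx] in \<open>simp add: poly_jacobi field_simps power2_eq_square\<close>)
  next
    show "continuous_on E (\<lambda>x. poly (?Q t) x * ln (poly (?Q t) x))" if "0 \<le> t" for t
      using Q that by (intro continuous_intros) auto
    show "continuous_on ({0..} \<times> E) (\<lambda>(t, x). ?\<psi>t t x)"
      unfolding case_prod_unfold poly_jacobi using Q by (intro continuous_intros) auto
  qed fact
  also have "integral E (\<lambda>x. ?\<psi>t t x - ?F t x) = - poly_fisher (heat t q)"
    by (simp add: poly_fisher_def)
  finally show ?thesis .
qed

text \<open>With \<open>v = ln Q\<close> the density \<open>\<psi> = \<Gamma> Q / Q = a Q v'\<^sup>2\<close> satisfies \<open>(\<partial>\<^sub>t - L) \<psi> = - 2 Q \<Gamma>\<^sub>2 v\<close>, and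
  \<open>\<Gamma>\<^sub>2 v = \<Gamma> v + (a v'' - x v')\<^sup>2 + x\<^sup>2 v'\<^sup>2\<close>. Written in \<open>Q\<close> and the derivatives
  \<open>v1\<close>, \<open>v2\<close>, \<open>v3\<close> of \<open>v\<close>, everything is polynomial; \<open>J\<close> and \<open>K\<close> are \<open>L Q / Q\<close> and \<open>(L Q)' / Q\<close>.\<close>

lemma poly_fisher_deriv:
  assumes pos: "\<And>x. x \<in> E \<Longrightarrow> 0 < poly q x" and t0: "0 \<le> t"
  obtains d where "((\<lambda>t. poly_fisher (heat t q)) has_real_derivative d) (at t within {0..})"
    "d \<le> - 2 * poly_fisher (heat t q)"
proof -
  define Q v1 v2 v3 where "Q t = poly (heat t q)"
    and "v1 t x = poly (pderiv (heat t q)) x / Q t x"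
    and "v2 t x = poly (pderiv (pderiv (heat t q))) x / Q t x - (v1 t x)\<^sup>2"
    and "v3 t x = poly (pderiv (pderiv (pderiv (heat t q)))) x / Q t x - 3 * v1 t x * v2 t x - (v1 t x) ^ 3" for t x
  note defs = v3_def v2_def v1_def Q_def
  have Q: "Q t x \<noteq> 0" "0 < Q t x" if "0 \<le> t" "x \<in> E" for t x
    using heat_pos[OF pos that] by (auto simp: Q_def)
  define J where "J t x = (1 - x\<^sup>2) * (v2 t x + (v1 t x)\<^sup>2) - 2 * x * v1 t x" for t x
  define K where "K t x = (1 - x\<^sup>2) * (v3 t x + 3 * v1 t x * v2 t x + (v1 t x) ^ 3)
     - 4 * x * (v2 t x + (v1 t x)\<^sup>2) - 2 * v1 t x" for t x
  let ?S = "{0..} \<times> E"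
  have cQ: "continuous_on ?S (\<lambda>z. Q (fst z) (snd z))"
    unfolding Q_def by (intro continuous_intros)
  have c1: "continuous_on ?S (\<lambda>z. v1 (fst z) (snd z))"
    unfolding v1_def by (intro continuous_intros cQ) (use Q in auto)
  have c2: "continuous_on ?S (\<lambda>z. v2 (fst z) (snd z))"
    unfolding v2_def by (intro continuous_intros cQ c1) (use Q in auto)
  have c3: "continuous_on ?S (\<lambda>z. v3 (fst z) (snd z))"
    unfolding v3_def by (intro continuous_intros cQ c1 c2) (use Q in auto)
  note joint = cQ c1 c2 c3
  have slice: "continuous_on E (f t)" if "continuous_on ?S (\<lambda>z. f (fst z) (snd z))" "0 \<le> t"
    for f :: "real \<Rightarrow> real \<Rightarrow> real" and t
  proof -
    have "continuous_on E (\<lambda>x. (t, x))" by (intro continuous_intros)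
    from continuous_on_compose2[OF that(1) this] that(2) show ?thesis by auto
  qed
  note slices = joint[THEN slice]
  have Q_dx: "(Q t has_real_derivative Q t x * v1 t x) (at x within E)"
    and v1_dx: "(v1 t has_real_derivative v2 t x) (at x within E)"
    and v2_dx: "(v2 t has_real_derivative v3 t x) (at x within E)" if tx: "0 \<le> t" "x \<in> E" for t x
  proof -
    note Q' = Q[OF tx, unfolded Q_def]
    show Q_dx: "(Q t has_real_derivative Q t x * v1 t x) (at x within E)"
      unfolding v1_def Q_def using Q' by (auto intro!: derivative_eq_intros)
    show v1_dx: "(v1 t has_real_derivative v2 t x) (at x within E)"
      unfolding v2_def v1_def Q_def using Q' by (auto intro!: derivative_eq_intros simp: field_simps power2_eq_square)
    have v2': "v2 t = (\<lambda>x. poly (pderiv (pderiv (heat t q))) x / Q t x - (v1 t x)\<^sup>2)"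
      by (simp add: v2_def fun_eq_iff)
    show "(v2 t has_real_derivative v3 t x) (at x within E)"
      unfolding v2'
      by (rule derivative_eq_intros v1_dx Q_dx refl poly_DERIV[THEN DERIV_subset] Q[OF tx] subset_UNIV)+
        (use Q[OF tx] in \<open>simp add: v3_def v2_def field_simps power2_eq_square power3_eq_cube\<close>)
  qed
  have Q_dt: "((\<lambda>t. Q t x) has_real_derivative Q t x * J t x) (at t within {0..})"
    and v1_dt: "((\<lambda>t. v1 t x) has_real_derivative K t x - v1 t x * J t x) (at t within {0..})"
    if tx: "0 \<le> t" "x \<in> E" for t x
  proof -
    note Q' = Q[OF tx, unfolded Q_def]
    have J: "poly (jacobi (heat t q)) x = Q t x * J t x"
      using Q[OF tx] by (simp add: J_def poly_jacobi v2_def v1_def field_simps)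
    have K: "poly (pderiv (jacobi (heat t q))) x = Q t x * K t x"
      using Q[OF tx] by (simp add: K_def poly_pderiv_jacobi v3_def) (simp add: v2_def v1_def field_simps)
    show Q_dt: "((\<lambda>t. Q t x) has_real_derivative Q t x * J t x) (at t within {0..})"
      unfolding J[symmetric] unfolding Q_def by (rule heat_derivs)
    show "((\<lambda>t. v1 t x) has_real_derivative K t x - v1 t x * J t x) (at t within {0..})"
      unfolding v1_def
      by (rule derivative_eq_intros Q_dt heat_derivs refl Q[OF tx])+
        (use Q[OF tx] in \<open>simp add: K field_simps\<close>)
  qed
  define \<psi> where "\<psi> t x = (1 - x\<^sup>2) * (Q t x * (v1 t x)\<^sup>2)" for t x
  define \<psi>t where "\<psi>t t x = (1 - x\<^sup>2) * Q t x * (2 * v1 t x * K t x - (v1 t x)\<^sup>2 * J t x)" for t x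
  define g where "g t x = Q t x * ((1 - x\<^sup>2) * (v1 t x) ^ 3 - 2 * x * (v1 t x)\<^sup>2
     + 2 * (1 - x\<^sup>2) * v1 t x * v2 t x)" for t x
  define g' where "g' t x = Q t x * (v1 t x * ((1 - x\<^sup>2) * (v1 t x) ^ 3 - 2 * x * (v1 t x)\<^sup>2
       + 2 * (1 - x\<^sup>2) * v1 t x * v2 t x)
     - 2 * x * (v1 t x) ^ 3 + 3 * (1 - x\<^sup>2) * (v1 t x)\<^sup>2 * v2 t x - 2 * (v1 t x)\<^sup>2
     - 8 * x * v1 t x * v2 t x + 2 * (1 - x\<^sup>2) * ((v2 t x)\<^sup>2 + v1 t x * v3 t x))" for t x
  define F where "F t x = (1 - x\<^sup>2) * g' t x - 2 * x * g t x" for t x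
  have deriv: "((\<lambda>t. integral E (\<psi> t)) has_real_derivative integral E (\<lambda>x. \<psi>t t x - F t x)) (at t within {0..})"
  proof (rule heat_dissipation[where g = g])
    fix t x :: real assume tx: "0 \<le> t" "x \<in> E"
    show "((\<lambda>t. \<psi> t x) has_real_derivative \<psi>t t x) (at t within {0..})"
      unfolding \<psi>_def
      by (rule derivative_eq_intros Q_dt[OF tx] v1_dt[OF tx] refl)+
        (simp add: \<psi>t_def algebra_simps power2_eq_square)
    have "(g t has_real_derivative g' t x) (at x within E)"
      unfolding g_def
      by (rule derivative_eq_intros Q_dx[OF tx] v1_dx[OF tx] v2_dx[OF tx] refl)+
        (simp add: g'_def algebra_simps power2_eq_square power3_eq_cube)
    then show "((\<lambda>x. (1 - x\<^sup>2) * g t x) has_real_derivative F t x) (at x within E)"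
      by (auto intro!: derivative_eq_intros simp: F_def)
  next
    show "continuous_on E (\<psi> t)" if "0 \<le> t" for t
      unfolding \<psi>_def by (intro continuous_intros slices that)
    show "continuous_on ({0..} \<times> E) (\<lambda>(t, x). \<psi>t t x)"
      unfolding case_prod_unfold \<psi>t_def J_def K_def by (intro continuous_intros joint)
  qed fact
  have le: "integral E (\<lambda>x. \<psi>t t x - F t x) \<le> integral E (\<lambda>x. - 2 * \<psi> t x)"
  proof (rule integral_le)
    show "(\<lambda>x. \<psi>t t x - F t x) integrable_on E"
      unfolding \<psi>t_def F_def g_def g'_def J_def K_def
      by (intro integrable_continuous_interval continuous_intros slices t0)
    show "(\<lambda>x. - 2 * \<psi> t x) integrable_on E"
      unfolding \<psi>_def by (intro integrable_continuous_interval continuous_intros slices t0)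
    fix x assume x: "x \<in> E"
    have "\<psi>t t x - F t x = - 2 * \<psi> t x - 2 * Q t x * (((1 - x\<^sup>2) * v2 t x - x * v1 t x)\<^sup>2 + x\<^sup>2 * (v1 t x)\<^sup>2)"
      unfolding \<psi>t_def F_def g_def g'_def J_def K_def \<psi>_def by algebra
    also have "\<dots> \<le> - 2 * \<psi> t x" using Q[OF t0 x] by simp
    finally show "\<psi>t t x - F t x \<le> - 2 * \<psi> t x" .
  qed
  have eq: "integral E (\<psi> t) = poly_fisher (heat t q)" if "0 \<le> t" for t
    unfolding poly_fisher_def by (intro integral_cong) (use Q[OF that] in \<open>simp add: \<psi>_def v1_def Q_def field_simps power2_eq_square\<close>)
  show ?thesis
  proof (rule that)
    show "((\<lambda>t. poly_fisher (heat t q)) has_real_derivative integral E (\<lambda>x. \<psi>t t x - F t x)) (at t within {0..})"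
      by (rule has_field_derivative_transform_within[OF deriv zero_less_one]) (use t0 eq in auto)
    show "integral E (\<lambda>x. \<psi>t t x - F t x) \<le> - 2 * poly_fisher (heat t q)"
      using le eq[OF t0] by simp
  qed
qed


lemma poly_fisher_decay:
  assumes pos: "\<And>x. x \<in> E \<Longrightarrow> 0 < poly q x" and "0 \<le> t"
  shows "poly_fisher (heat t q) \<le> exp (- 2 * t) * poly_fisher q"
proof -
  have "\<forall>t. \<exists>d. 0 \<le> t \<longrightarrow> ((\<lambda>t. poly_fisher (heat t q)) has_real_derivative d) (at t within {0..})
      \<and> d \<le> - 2 * poly_fisher (heat t q)"
  proof
    fix t :: real
    show "\<exists>d. 0 \<le> t \<longrightarrow> ((\<lambda>t. poly_fisher (heat t q)) has_real_derivative d) (at t within {0..})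
      \<and> d \<le> - 2 * poly_fisher (heat t q)"
    proof (cases "0 \<le> t")
      case True
      show ?thesis by (rule poly_fisher_deriv[of q t, OF pos True]) auto
    qed auto
  qed
  from choice[OF this] obtain d where
    d: "\<And>t. 0 \<le> t \<Longrightarrow> ((\<lambda>t. poly_fisher (heat t q)) has_real_derivative d t) (at t within {0..})"
      "\<And>t. 0 \<le> t \<Longrightarrow> d t \<le> - 2 * poly_fisher (heat t q)"
    by blast
  define G where "G t = - (exp (2 * t) * poly_fisher (heat t q))" for t
  have "G 0 \<le> G t"
  proof (rule nondecreasing_within_Ici[of 0 t G "\<lambda>s. - (exp (2 * s) * (2 * poly_fisher (heat s q) + d s))"])
    fix s :: real assume "0 \<le> s"
    then show "(G has_real_derivative - (exp (2 * s) * (2 * poly_fisher (heat s q) + d s))) (at s within {0..})"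
      unfolding G_def[abs_def] by (auto intro!: derivative_eq_intros d simp: algebra_simps)
    show "0 \<le> - (exp (2 * s) * (2 * poly_fisher (heat s q) + d s))"
      using d(2)[OF \<open>0 \<le> s\<close>] by (simp add: mult_nonneg_nonpos)
  qed (use assms in auto)
  then show ?thesis by (simp add: G_def exp_minus field_simps)
qed

text \<open>The derivative of \<open>H(Q\<^sub>t) - exp (- 2 t) I(q) / 2\<close> is \<open>exp (- 2 t) I(q) - I(Q\<^sub>t)\<close>, which is
  non-negative by the decay of the Fisher information.\<close>

lemma poly_entropy_step:
  assumes pos: "\<And>x. x \<in> E \<Longrightarrow> 0 < poly q x" and "0 \<le> s" "s \<le> t"
  shows "poly_entropy (heat s q) - exp (- 2 * s) / 2 * poly_fisher q
    \<le> poly_entropy (heat t q) - exp (- 2 * t) / 2 * poly_fisher q"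
proof -
  define G where "G t = poly_entropy (heat t q) - exp (- 2 * t) / 2 * poly_fisher q" for t
  define G' where "G' t = exp (- 2 * t) * poly_fisher q - poly_fisher (heat t q)" for t
  have "G s \<le> G t"
  proof (rule nondecreasing_within_Ici[of s t G G'])
    fix r :: real assume "s \<le> r"
    then have r: "0 \<le> r" using assms by simp
    have "(G has_real_derivative (- poly_fisher (heat r q)) - (- 2 * exp (- 2 * r)) / 2 * poly_fisher q) (at r within {0..})"
      unfolding G_def[abs_def]
      by (intro DERIV_diff poly_entropy_deriv DERIV_cmult_right DERIV_cdivide pos r)
        (auto intro!: derivative_eq_intros)
    then show "(G has_real_derivative G' r) (at r within {0..})"
      by (simp add: G'_def)
    show "0 \<le> G' r"
      using poly_fisher_decay[of q r, OF pos r] by (simp add: G'_def)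
  qed (use assms in auto)
  then show ?thesis by (simp add: G_def)
qed

text \<open>Only the component of eigenvalue \<open>0\<close> survives. It is a constant, by the coefficient formula at its
  degree, and it carries the whole mass because the other components are orthogonal to \<open>1\<close>.\<close>

lemma heat_limit: "(\<lambda>n. poly (heat (real n) q) x) \<longlonglongrightarrow> integral E (poly q) / 2"
proof (rule eigen_expansion[of q])
  fix e n assume e: "eigen_family e" "q = (\<Sum>k\<le>n. e k)"
    and t: "\<And>t. heat t q = (\<Sum>k\<le>n. smult (exp (- eigenvalue k * t)) (e k))"
  have "jacobi (e 0) = 0" using e(1) by (simp add: eigen_family_def)
  then have "coeff (jacobi (e 0)) (degree (e 0)) = 0" by simp
  then have "degree (e 0) = 0" by (auto simp: coeff_jacobi coeff_eq_0)
  then obtain c where c: "e 0 = [:c:]" using degree_eq_zeroE by blast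
  have one: "eigen_family (\<lambda>k. if k = 0 then [:1:] else 0)"
    by (simp add: eigen_family_def jacobi_def)
  have "integral E (poly q) = (\<Sum>k\<le>n. pairing (e k) [:1:])"
    using pairing_sum_left[of e "{..n}" "[:1:]"] by (simp add: e(2)[symmetric] pairing_def)
  also have "\<dots> = (\<Sum>k\<le>n. if k = 0 then 2 * c else 0)"
    using eigen_orthogonal[OF e(1) one, of _ 0] by (intro sum.cong) (auto simp: c pairing_def)
  finally have "integral E (poly q) = 2 * c" by simp
  moreover have "(\<lambda>i. poly (heat (real i) q) x) \<longlonglongrightarrow> (\<Sum>k\<le>n. if k = 0 then c else 0)"
    unfolding t poly_sum poly_smult
  proof (rule tendsto_sum)
    fix k
    have "(\<lambda>i. exp (- eigenvalue k * real i)) \<longlonglongrightarrow> 0" if "k \<noteq> 0"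
    proof -
      have "filterlim (\<lambda>i. eigenvalue k * real i) at_top sequentially"
        using that by (intro filterlim_tendsto_pos_mult_at_top[OF tendsto_const] filterlim_real_sequentially) auto
      then show ?thesis
        by (auto intro!: filterlim_compose[OF exp_at_bot] simp: filterlim_uminus_at_bot)
    qed
    then show "(\<lambda>i. exp (- eigenvalue k * real i) * poly (e k) x) \<longlonglongrightarrow> (if k = 0 then c else 0)"
      by (cases "k = 0") (auto simp: c intro!: tendsto_mult_left_zero)
  qed
  ultimately show ?thesis by simp
qed

lemma abs_ln_le:
  fixes y :: real
  assumes "0 < m" "m \<le> y" "y \<le> M"
  shows "\<bar>ln y\<bar> \<le> M + 1 / m"
proof -
  have y: "0 < y" using assms by linarith
  have "ln y \<le> y" "ln (1 / y) \<le> 1 / y" using ln_le_minus_one[of y] ln_le_minus_one[of "1 / y"] y by auto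
  then have "ln y \<le> y" "- ln y \<le> 1 / y" using y by (simp_all add: ln_div)
  moreover have "1 / y \<le> 1 / m" using assms by (simp add: frac_le)
  moreover have "0 < 1 / m" "0 < M" using assms by auto
  ultimately show ?thesis using assms by linarith
qed

lemma poly_entropy_limit:
  assumes pos: "\<And>x. x \<in> E \<Longrightarrow> 0 < poly q x"
  defines "\<kappa> \<equiv> integral E (poly q) / 2"
  shows "(\<lambda>n. poly_entropy (heat (real n) q)) \<longlonglongrightarrow> 2 * (\<kappa> * ln \<kappa>)"
proof -
  obtain m M where m: "0 < m" "\<And>x. x \<in> E \<Longrightarrow> m \<le> poly q x" "\<And>x. x \<in> E \<Longrightarrow> poly q x \<le> M"
    using poly_pos_bounds[of q] pos by blast
  have Q: "m \<le> poly (heat t q) x" "poly (heat t q) x \<le> M" if "0 \<le> t" "x \<in> E" for t x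
    using heat_ge[OF m(2) that] heat_le[OF m(3) that] by auto
  have "m \<le> \<kappa>"
    by (rule LIMSEQ_le_const[OF heat_limit[of q 0, folded \<kappa>_def]]) (use Q in auto)
  have "(\<lambda>n. poly_entropy (heat (real n) q)) \<longlonglongrightarrow> integral E (\<lambda>x. \<kappa> * ln \<kappa>)"
    unfolding poly_entropy_def
  proof (rule dominated_convergence(2)[where h = "\<lambda>_. M * (M + 1 / m)"])
    show "(\<lambda>x. poly (heat (real n) q) x * ln (poly (heat (real n) q) x)) integrable_on E" for n
      using heat_pos[OF pos, of "real n"]
      by (intro integrable_continuous_interval continuous_intros) force+
    show "norm (poly (heat (real n) q) x * ln (poly (heat (real n) q) x)) \<le> M * (M + 1 / m)" if "x \<in> E" for n x
      using Q[of "real n" x] that abs_ln_le[OF m(1) Q, of "real n" x] m(1)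
      by (auto simp: abs_mult intro!: mult_mono)
    show "(\<lambda>n. poly (heat (real n) q) x * ln (poly (heat (real n) q) x)) \<longlonglongrightarrow> \<kappa> * ln \<kappa>" for x
      unfolding \<kappa>_def using \<open>m \<le> \<kappa>\<close> m(1) by (intro tendsto_intros heat_limit) (auto simp: \<kappa>_def)
  qed auto
  then show ?thesis by (simp add: mult_ac)
qed

text \<open>The logarithmic Sobolev inequality along the flow, for a density of arbitrary mean \<open>\<kappa>\<close>: let the
  upper time tend to infinity in the monotone quantity. Polynomial approximations of a probability
  density need not be normalised exactly, whence the last term.\<close>

lemma poly_log_sobolev:
  assumes pos: "\<And>x. x \<in> E \<Longrightarrow> 0 < poly q x" and "0 \<le> t"
  defines "\<kappa> \<equiv> integral E (poly q) / 2"
  shows "poly_entropy (heat t q) \<le> exp (- 2 * t) / 2 * poly_fisher q + 2 * (\<kappa> * ln \<kappa>)"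
proof -
  have "(\<lambda>n. exp (- 2 * real n)) \<longlonglongrightarrow> 0"
    by (rule filterlim_compose[OF exp_at_bot])
      (auto intro!: filterlim_tendsto_pos_mult_at_top[OF tendsto_const] filterlim_real_sequentially
        simp: filterlim_uminus_at_bot)
  then have "(\<lambda>n. poly_entropy (heat (real n) q) - exp (- 2 * real n) / 2 * poly_fisher q) \<longlonglongrightarrow> 2 * (\<kappa> * ln \<kappa>) - 0 / 2 * poly_fisher q"
    unfolding \<kappa>_def by (intro tendsto_intros poly_entropy_limit pos) auto
  then have "poly_entropy (heat t q) - exp (- 2 * t) / 2 * poly_fisher q \<le> 2 * (\<kappa> * ln \<kappa>) - 0 / 2 * poly_fisher q"
  proof (rule LIMSEQ_le_const, intro exI allI impI)
    fix n assume "nat \<lceil>t\<rceil> \<le> n"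
    then have "t \<le> real n" by linarith
    then show "poly_entropy (heat t q) - exp (- 2 * t) / 2 * poly_fisher q
       \<le> poly_entropy (heat (real n) q) - exp (- 2 * real n) / 2 * poly_fisher q"
      using poly_entropy_step[OF pos \<open>0 \<le> t\<close>] by blast
  qed
  then show ?thesis by simp
qed


section \<open>Polynomial approximation with two derivatives\<close>

lemma ex_antiderivative: "\<exists>P. pderiv P = p" for p :: "real poly"
proof -
  have "pderiv (\<Sum>i\<le>degree p. monom (coeff p i / real (Suc i)) (Suc i)) = (\<Sum>i\<le>degree p. monom (coeff p i) i)"
    by (simp add: pderiv_sum pderiv_monom del: of_nat_Suc)
  then show ?thesis by (auto simp: poly_as_sum_of_monoms)
qed

lemma poly_approx:
  assumes "continuous_on E g" "0 < \<epsilon>"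
  shows "\<exists>p. \<forall>x\<in>E. \<bar>poly p x - g x\<bar> \<le> \<epsilon>"
proof -
  obtain f where f: "real_polynomial_function f" "\<And>x. x \<in> E \<Longrightarrow> \<bar>g x - f x\<bar> < \<epsilon>"
    using Stone_Weierstrass_real_polynomial_function[OF _ assms] by auto
  then obtain a n where "f = (\<lambda>x. \<Sum>i\<le>n. a i * x ^ i)"
    using real_polynomial_function_iff_sum[of f] by auto
  then have "poly (\<Sum>i\<le>n. monom (a i) i) x = f x" for x
    by (simp add: poly_sum poly_monom)
  with f(2) show ?thesis by (intro exI[of _ "\<Sum>i\<le>n. monom (a i) i"]) (auto simp: abs_minus_commute intro: less_imp_le)
qed

lemma poly_approx_integrate:
  assumes f: "\<And>x. x \<in> E \<Longrightarrow> (f has_real_derivative f' x) (at x within E)"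
    and p: "\<And>x. x \<in> E \<Longrightarrow> \<bar>poly p x - f' x\<bar> \<le> \<epsilon>"
  shows "\<exists>P. pderiv P = p \<and> (\<forall>x\<in>E. \<bar>poly P x - f x\<bar> \<le> 2 * \<epsilon>)"
proof -
  obtain P0 where P0: "pderiv P0 = p" using ex_antiderivative by blast
  define P where "P = P0 + [:f (-1) - poly P0 (-1):]"
  have P: "pderiv P = p" "poly P (-1) = f (-1)" using P0 by (simp_all add: P_def pderiv_add)
  have "\<bar>poly P x - f x\<bar> \<le> 2 * \<epsilon>" if x: "x \<in> E" for x
  proof -
    have "norm ((poly P x - f x) - (poly P (-1) - f (-1))) \<le> \<epsilon> * norm (x - (-1))"
    proof (rule field_differentiable_bound)
      show "((\<lambda>x. poly P x - f x) has_field_derivative poly p z - f' z) (at z within E)" if "z \<in> E" for z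
        using that P(1) by (auto intro!: derivative_eq_intros f)
    qed (use p x in auto)
    also have "\<dots> \<le> \<epsilon> * 2"
      using x p[OF x] by (intro mult_left_mono) auto
    finally show ?thesis using P(2) by simp
  qed
  with P(1) show ?thesis by blast
qed

text \<open>Approximate the second derivative and integrate twice; each integration from \<open>-1\<close> costs a factor
  \<open>2\<close>, the length of the interval.\<close>

lemma C2_poly_approx:
  assumes "\<And>x. x \<in> E \<Longrightarrow> (v has_real_derivative v1 x) (at x within E)"
    and "\<And>x. x \<in> E \<Longrightarrow> (v1 has_real_derivative v2 x) (at x within E)"
    and "continuous_on E v2" "0 < \<epsilon>"
  shows "\<exists>p. \<forall>x\<in>E. \<bar>poly p x - v x\<bar> \<le> \<epsilon> \<and> \<bar>poly (pderiv p) x - v1 x\<bar> \<le> \<epsilon> \<and>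
    \<bar>poly (pderiv (pderiv p)) x - v2 x\<bar> \<le> \<epsilon>"
proof -
  have "\<exists>p. \<forall>x\<in>E. \<bar>poly p x - v2 x\<bar> \<le> \<epsilon> / 4"
    by (rule poly_approx) (use assms(3,4) in auto)
  then obtain p2 where p2: "\<And>x. x \<in> E \<Longrightarrow> \<bar>poly p2 x - v2 x\<bar> \<le> \<epsilon> / 4" by blast
  have "\<exists>P. pderiv P = p2 \<and> (\<forall>x\<in>E. \<bar>poly P x - v1 x\<bar> \<le> 2 * (\<epsilon> / 4))"
    by (rule poly_approx_integrate[OF assms(2) p2])
  then obtain p1 where p1: "pderiv p1 = p2" "\<And>x. x \<in> E \<Longrightarrow> \<bar>poly p1 x - v1 x\<bar> \<le> 2 * (\<epsilon> / 4)"
    by blast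
  have "\<exists>P. pderiv P = p1 \<and> (\<forall>x\<in>E. \<bar>poly P x - v x\<bar> \<le> 2 * (2 * (\<epsilon> / 4)))"
    by (rule poly_approx_integrate[OF assms(1) p1(2)])
  then obtain p where p: "pderiv p = p1" "\<And>x. x \<in> E \<Longrightarrow> \<bar>poly p x - v x\<bar> \<le> 2 * (2 * (\<epsilon> / 4))"
    by blast
  have "\<bar>poly p x - v x\<bar> \<le> \<epsilon> \<and> \<bar>poly (pderiv p) x - v1 x\<bar> \<le> \<epsilon> \<and>
    \<bar>poly (pderiv (pderiv p)) x - v2 x\<bar> \<le> \<epsilon>" if "x \<in> E" for x
    using p p1 p2[OF that] p(2)[OF that] p1(2)[OF that] \<open>0 < \<epsilon>\<close> by simp
  then show ?thesis by blast
qed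

section \<open>The Stein bound on the Fisher information\<close>

text \<open>All that is used about a Stein kernel. For fixed \<open>f\<close>, optimising over \<open>c\<close> gives the Cauchy-Schwarz
  form \<open>(\<integral> L f h)\<^sup>2 \<le> s \<integral> (a f'')\<^sup>2 h\<close>; the form with a free \<open>c\<close> is linear in \<open>h\<close>. Integrals
  against \<open>dx\<close> double those against \<open>\<mu>\<close>, so \<open>s\<close> stands for \<open>2 S\<^sup>2\<close>.\<close>

definition stein_bound :: "(real \<Rightarrow> real) \<Rightarrow> real \<Rightarrow> bool" where
  "stein_bound h s \<longleftrightarrow> (\<forall>f c. 0 < c \<longrightarrow>
     - 2 * integral E (\<lambda>x. poly (jacobi f) x * h x)
       \<le> c * s + integral E (\<lambda>x. ((1 - x\<^sup>2) * poly (pderiv (pderiv f)) x)\<^sup>2 * h x) / c)"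

text \<open>The nonlinear operator \<open>- 2 L p - \<Gamma> p\<close>. Integrated against a density \<open>Q\<close> it gives
  \<open>2 \<integral> p' Q' a - \<integral> p'\<^sup>2 Q a\<close>, and the supremum over all smooth \<open>p\<close> is the Fisher information of
  \<open>Q\<close>, attained at \<open>p = ln Q\<close>.\<close>

definition log_source :: "real poly \<Rightarrow> real poly" where
  "log_source p = - smult 2 (jacobi p) - carre_du_champ p"

lemma poly_log_source: "poly (log_source p) x
    = - 2 * ((1 - x\<^sup>2) * poly (pderiv (pderiv p)) x - 2 * x * poly (pderiv p) x) - (1 - x\<^sup>2) * (poly (pderiv p) x)\<^sup>2"
  by (simp add: log_source_def poly_carre_du_champ poly_jacobi)

lemma heat_log_source: "heat t (log_source p) = - smult 2 (jacobi (heat t p)) - heat t (carre_du_champ p)"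
  using heat_smult[of t "-2" "jacobi p"] by (simp add: log_source_def heat_diff heat_jacobi)

text \<open>The Stein bound for \<open>f = P\<^sub>t p\<close> with \<open>c = 2 / (exp (2 t) - 1)\<close>: by the Hessian bound the quadratic
  term \<open>(a f'')\<^sup>2 / c\<close> is at most \<open>P\<^sub>t (\<Gamma> p)\<close>, so it can be moved to the left.\<close>

lemma stein_heat_bound:
  assumes stein: "stein_bound h s" and cont: "continuous_on E h" and h: "\<And>x. x \<in> E \<Longrightarrow> 0 \<le> h x"
    and t: "0 < t"
  shows "integral E (\<lambda>x. poly (heat t (log_source p)) x * h x) \<le> 2 / (exp (2 * t) - 1) * s"
proof -
  define c where "c = 2 / (exp (2 * t) - 1)"
  have e: "1 < exp (2 * t)" using t by simp
  then have c: "0 < c" by (simp add: c_def)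
  let ?f = "heat t p"
  let ?B = "\<lambda>x. ((1 - x\<^sup>2) * poly (pderiv (pderiv ?f)) x)\<^sup>2"
  have int: "(\<lambda>x. g x * h x) integrable_on E" if "continuous_on E g" for g :: "real \<Rightarrow> real"
    using that cont by (intro integrable_continuous_interval continuous_intros)
  have "integral E (\<lambda>x. poly (heat t (log_source p)) x * h x)
     \<le> integral E (\<lambda>x. - 2 * (poly (jacobi ?f) x * h x) - ?B x * h x / c)"
  proof (rule integral_le)
    show "(\<lambda>x. - 2 * (poly (jacobi ?f) x * h x) - ?B x * h x / c) integrable_on E"
      using cont c by (intro integrable_continuous_interval continuous_intros) auto
    fix x assume x: "x \<in> E"
    have "?B x / c = (exp (2 * t) - 1) / 2 * ?B x" by (simp add: c_def)
    also have "\<dots> \<le> poly (heat t (carre_du_champ p)) x"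
    proof -
      have "0 \<le> exp (2 * t) * ((1 - x\<^sup>2) * (poly (pderiv (heat t p)) x)\<^sup>2)"
        using one_minus_square_nonneg[OF x] by simp
      then show ?thesis using heat_gradient_hessian_bound[of t x p] t x by linarith
    qed
    finally have "(- 2 * poly (jacobi ?f) x - poly (heat t (carre_du_champ p)) x) * h x
        \<le> (- 2 * poly (jacobi ?f) x - ?B x / c) * h x"
      using h[OF x] by (intro mult_right_mono) auto
    then show "poly (heat t (log_source p)) x * h x \<le> - 2 * (poly (jacobi ?f) x * h x) - ?B x * h x / c"
      by (simp add: heat_log_source algebra_simps)
  qed (intro int continuous_intros)
  also have "\<dots> = - 2 * integral E (\<lambda>x. poly (jacobi ?f) x * h x) - integral E (\<lambda>x. ?B x * h x) / c"
  proof -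
    have 1: "(\<lambda>x. - 2 * (poly (jacobi ?f) x * h x)) integrable_on E"
      and 2: "(\<lambda>x. ?B x * h x / c) integrable_on E"
      using cont c by (intro integrable_continuous_interval continuous_intros; simp)+
    show ?thesis
      unfolding Henstock_Kurzweil_Integration.integral_diff[OF 1 2]
      by (simp add: integral_divide)
  qed
  also have "\<dots> \<le> c * s"
  proof -
    have "- 2 * integral E (\<lambda>x. poly (jacobi ?f) x * h x) \<le> c * s + integral E (\<lambda>x. ?B x * h x) / c"
      using stein c unfolding stein_bound_def by blast
    then show ?thesis by linarith
  qed
  finally show ?thesis by (simp add: c_def)
qed

text \<open>Choose \<open>p\<close> close to \<open>v = ln (P\<^sub>t q)\<close> in \<open>C\<^sup>2\<close> in the preceding bound and move \<open>P\<^sub>t\<close> onto \<open>q\<close> by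
  symmetry, after replacing \<open>h\<close> by \<open>q\<close>. The replacement costs \<open>2 \<epsilon>\<close> times the supremum of
  \<open>- 2 L v - \<Gamma> v = - 2 L Q / Q + \<Gamma> Q / Q\<^sup>2\<close>. By the maximum principle and the gradient bound this
  is controlled by \<open>q\<close> at time \<open>0\<close>, so that the constant is uniform in \<open>t\<close> and as \<open>q\<close> approaches \<open>h\<close>.\<close>

lemma stein_fisher_bound:
  assumes stein: "stein_bound h s" and cont: "continuous_on E h" and h: "\<And>x. x \<in> E \<Longrightarrow> 0 \<le> h x"
    and close: "\<And>x. x \<in> E \<Longrightarrow> \<bar>poly q x - h x\<bar> \<le> \<epsilon>"
    and m: "0 < m" "\<And>x. x \<in> E \<Longrightarrow> m \<le> poly q x"
    and K: "\<And>x. x \<in> E \<Longrightarrow> \<bar>poly (pderiv q) x\<bar> \<le> K" "\<And>x. x \<in> E \<Longrightarrow> \<bar>poly (pderiv (pderiv q)) x\<bar> \<le> K"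
    and t: "0 < t"
  shows "poly_fisher (heat t q) \<le> 2 / (exp (2 * t) - 1) * s + 2 * \<epsilon> * (6 * K / m + K\<^sup>2 / m\<^sup>2)"
proof -
  define Q Q1 Q2 where "Q = poly (heat t q)" and "Q1 = poly (pderiv (heat t q))"
    and "Q2 = poly (pderiv (pderiv (heat t q)))"
  note defs = Q_def Q1_def Q2_def
  define LQ where "LQ x = (1 - x\<^sup>2) * Q2 x - 2 * x * Q1 x" for x
  define C where "C = 6 * K / m + K\<^sup>2 / m\<^sup>2"
  define W where "W = integral E (\<lambda>x. Q x)"
  have K0: "0 \<le> K" using K(1)[of 0] by simp
  have \<epsilon>0: "0 \<le> \<epsilon>" using close[of 0] by simp
  have C0: "0 \<le> C" using K0 m(1) by (simp add: C_def)
  have Qm: "m \<le> Q x" if "x \<in> E" for x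
    unfolding Q_def using heat_ge[OF m(2)] that t by simp
  then have Q: "0 < Q x" "Q x \<noteq> 0" if "x \<in> E" for x
    using m(1) that by (force, force)
  have cQ: "continuous_on E Q" "continuous_on E Q1" "continuous_on E Q2"
    unfolding defs by (intro continuous_intros)+
  define v1 v2 where "v1 x = Q1 x / Q x" and "v2 x = Q2 x / Q x - (Q1 x / Q x)\<^sup>2" for x
  define Jv where "Jv x = - 2 * ((1 - x\<^sup>2) * v2 x - 2 * x * v1 x) - (1 - x\<^sup>2) * (v1 x)\<^sup>2" for x
  have Jv: "Jv x = - 2 * (LQ x / Q x) + (1 - x\<^sup>2) * (Q1 x)\<^sup>2 / (Q x)\<^sup>2" if "x \<in> E" for x
    using Q[OF that] by (simp add: Jv_def v1_def v2_def LQ_def field_simps power2_eq_square)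
  have cv: "continuous_on E v1" "continuous_on E v2"
    unfolding v1_def[abs_def] v2_def[abs_def] using Q by (intro continuous_intros cQ; simp)+
  then have cJv: "continuous_on E Jv"
    unfolding Jv_def[abs_def] by (intro continuous_intros)
  have Jv_le: "\<bar>Jv x\<bar> \<le> C" if x: "x \<in> E" for x
  proof -
    have "\<bar>poly (jacobi q) y\<bar> \<le> 3 * K" if "y \<in> E" for y
    proof -
      have "\<bar>(1 - y\<^sup>2) * poly (pderiv (pderiv q)) y\<bar> \<le> 1 * K"
        unfolding abs_mult using one_minus_square_nonneg[OF that] K(2)[OF that] by (intro mult_mono) auto
      moreover have "\<bar>2 * y * poly (pderiv q) y\<bar> \<le> 2 * K"
        unfolding abs_mult using that K(1)[OF that] by (intro mult_mono) auto
      ultimately show ?thesis unfolding poly_jacobi by linarith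
    qed
    then have "\<bar>poly (heat t (jacobi q)) x\<bar> \<le> 3 * K" using t x by (intro heat_abs_le) auto
    then have LQ: "\<bar>LQ x\<bar> \<le> 3 * K" by (simp add: heat_jacobi poly_jacobi LQ_def defs)
    have "poly (carre_du_champ q) y \<le> K\<^sup>2" if "y \<in> E" for y
    proof -
      have "(1 - y\<^sup>2) * (poly (pderiv q) y)\<^sup>2 \<le> 1 * K\<^sup>2"
        using one_minus_square_nonneg[OF that] power_mono[OF K(1)[OF that], of 2]
        by (intro mult_mono) auto
      then show ?thesis by (simp add: poly_carre_du_champ)
    qed
    then have "poly (heat t (carre_du_champ q)) x \<le> K\<^sup>2" using t x by (intro heat_le) auto
    moreover have "0 \<le> (exp (2 * t) - 1) / 2 * ((1 - x\<^sup>2) * Q2 x)\<^sup>2" using t by simp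
    moreover have "1 * ((1 - x\<^sup>2) * (Q1 x)\<^sup>2) \<le> exp (2 * t) * ((1 - x\<^sup>2) * (Q1 x)\<^sup>2)"
      using t one_minus_square_nonneg[OF x] by (intro mult_right_mono) auto
    ultimately have G: "(1 - x\<^sup>2) * (Q1 x)\<^sup>2 \<le> K\<^sup>2"
      using heat_gradient_hessian_bound[of t x q] t x unfolding defs by linarith
    have "\<bar>LQ x / Q x\<bar> \<le> 3 * K / m"
      unfolding abs_divide using LQ Qm[OF x] m(1) Q[OF x] by (intro frac_le) auto
    moreover have "(1 - x\<^sup>2) * (Q1 x)\<^sup>2 / (Q x)\<^sup>2 \<le> K\<^sup>2 / m\<^sup>2"
      using G Qm[OF x] m(1) by (intro frac_le) (auto intro: power_mono)
    moreover have "0 \<le> (1 - x\<^sup>2) * (Q1 x)\<^sup>2 / (Q x)\<^sup>2"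
      using one_minus_square_nonneg[OF x] by simp
    ultimately show ?thesis unfolding Jv[OF x] C_def by linarith
  qed
  have fisher: "poly_fisher (heat t q) = integral E (\<lambda>x. Jv x * Q x)"
  proof -
    have "integral E (\<lambda>x. poly (jacobi (heat t q)) x) = 0"
      using pairing_jacobi[of "heat t q" "[:1:]"] by (simp add: pairing_def jacobi_def)
    then have 0: "integral E LQ = 0" by (simp add: LQ_def[abs_def] defs poly_jacobi)
    have "integral E (\<lambda>x. Jv x * Q x) = integral E (\<lambda>x. - 2 * LQ x + (1 - x\<^sup>2) * (Q1 x)\<^sup>2 / Q x)"
      by (intro integral_cong) (use Q in \<open>simp add: Jv field_simps power2_eq_square\<close>)
    also have "\<dots> = - 2 * integral E LQ + integral E (\<lambda>x. (1 - x\<^sup>2) * (Q1 x)\<^sup>2 / Q x)"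
    proof (subst Henstock_Kurzweil_Integration.integral_add)
      show "(\<lambda>x. - 2 * LQ x) integrable_on E"
        unfolding LQ_def by (intro integrable_continuous_interval continuous_intros cQ)
      show "(\<lambda>x. (1 - x\<^sup>2) * (Q1 x)\<^sup>2 / Q x) integrable_on E"
        by (intro integrable_continuous_interval continuous_intros cQ) (use Q in auto)
    qed simp
    finally show ?thesis using 0 by (simp add: poly_fisher_def defs)
  qed
  have cW: "0 \<le> W" unfolding W_def
    by (intro Henstock_Kurzweil_Integration.integral_nonneg integrable_continuous_interval cQ) (use Q in \<open>auto intro: less_imp_le\<close>)
  have key: "poly_fisher (heat t q) \<le> 2 / (exp (2 * t) - 1) * s + 2 * \<epsilon> * (C + \<eta>) + \<eta> * W" if \<eta>: "0 < \<eta>" for \<eta>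
  proof -
    have "\<exists>V. \<forall>x\<in>E. \<bar>v1 x\<bar> \<le> V"
      using compact_continuous_image[OF cv(1), THEN compact_imp_bounded] by (auto simp: bounded_iff)
    then obtain V where V: "\<And>x. x \<in> E \<Longrightarrow> \<bar>v1 x\<bar> \<le> V" by blast
    have V0: "0 \<le> V" using V[of 0] by simp
    \<comment> \<open>Accuracy \<open>\<delta>\<close> in \<open>C\<^sup>2\<close> changes the source by at most \<open>(2 + 4 + 1 + 2 V) \<delta>\<close>.\<close>
    define \<delta> where "\<delta> = min 1 (\<eta> / (2 * V + 7))"
    have \<delta>: "0 < \<delta>" "\<delta> \<le> 1" using \<eta> V0 by (auto simp: \<delta>_def)
    have "\<delta> \<le> \<eta> / (2 * V + 7)" by (simp add: \<delta>_def)
    then have \<delta>_le: "\<delta> * (2 * V + 7) \<le> \<eta>" using V0 by (simp add: pos_le_divide_eq)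
    have "\<exists>p. \<forall>x\<in>E. \<bar>poly p x - ln (Q x)\<bar> \<le> \<delta> \<and> \<bar>poly (pderiv p) x - v1 x\<bar> \<le> \<delta> \<and>
        \<bar>poly (pderiv (pderiv p)) x - v2 x\<bar> \<le> \<delta>"
    proof (rule C2_poly_approx)
      fix x assume x: "x \<in> E"
      show "((\<lambda>x. ln (Q x)) has_real_derivative v1 x) (at x within E)"
        unfolding v1_def defs using Q[OF x, unfolded defs]
        by (auto intro!: derivative_eq_intros)
      show "(v1 has_real_derivative v2 x) (at x within E)"
        unfolding v1_def[abs_def] v2_def defs using Q[OF x, unfolded defs]
        by (auto intro!: derivative_eq_intros simp: field_simps power2_eq_square)
    qed (use cv \<delta> in auto)
    then obtain p where p: "\<And>x. x \<in> E \<Longrightarrow> \<bar>poly (pderiv p) x - v1 x\<bar> \<le> \<delta>"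
        "\<And>x. x \<in> E \<Longrightarrow> \<bar>poly (pderiv (pderiv p)) x - v2 x\<bar> \<le> \<delta>" by blast
    define J where "J = log_source p"
    have J: "\<bar>poly J x - Jv x\<bar> \<le> \<eta>" if x: "x \<in> E" for x
    proof -
      define d1 d2 where "d1 = poly (pderiv p) x - v1 x" and "d2 = poly (pderiv (pderiv p)) x - v2 x"
      have d: "\<bar>d1\<bar> \<le> \<delta>" "\<bar>d2\<bar> \<le> \<delta>" using p[OF x] by (auto simp: d1_def d2_def)
      have "poly J x - Jv x = - 2 * ((1 - x\<^sup>2) * d2) + 4 * (x * d1) - (1 - x\<^sup>2) * (d1 * (d1 + 2 * v1 x))"
        unfolding J_def poly_log_source Jv_def d1_def d2_def by algebra
      moreover have "\<bar>(1 - x\<^sup>2) * d2\<bar> \<le> 1 * \<delta>"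
        unfolding abs_mult using one_minus_square_nonneg[OF x] d by (intro mult_mono) auto
      moreover have "\<bar>x * d1\<bar> \<le> 1 * \<delta>"
        unfolding abs_mult using x d by (intro mult_mono) auto
      moreover have "\<bar>(1 - x\<^sup>2) * (d1 * (d1 + 2 * v1 x))\<bar> \<le> 1 * (\<delta> * (1 + 2 * V))"
        unfolding abs_mult using one_minus_square_nonneg[OF x] d \<delta> V[OF x] by (intro mult_mono) auto
      ultimately have "\<bar>poly J x - Jv x\<bar> \<le> 2 * \<delta> + 4 * \<delta> + \<delta> * (1 + 2 * V)" by linarith
      also have "\<dots> = \<delta> * (2 * V + 7)" by (simp add: algebra_simps)
      finally show ?thesis using \<delta>_le by simp
    qed
    have "poly_fisher (heat t q) \<le> integral E (\<lambda>x. poly J x * Q x + \<eta> * Q x)"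
      unfolding fisher
    proof (rule integral_le)
      fix x assume x: "x \<in> E"
      have "Jv x * Q x \<le> (poly J x + \<eta>) * Q x"
        using J[OF x] Q[OF x] by (intro mult_right_mono) auto
      then show "Jv x * Q x \<le> poly J x * Q x + \<eta> * Q x" by (simp add: algebra_simps)
    qed (intro integrable_continuous_interval continuous_intros cJv cQ)+
    also have "\<dots> = pairing J (heat t q) + \<eta> * W"
      unfolding W_def pairing_def Q_def
      by (subst Henstock_Kurzweil_Integration.integral_add) 
        (intro integrable_continuous_interval continuous_intros | simp)+
    also have "pairing J (heat t q) = pairing (heat t J) q" by (simp add: heat_adjoint)
    also have "\<dots> \<le> integral E (\<lambda>x. poly (heat t J) x * h x + \<epsilon> * (C + \<eta>))"
      unfolding pairing_def
    proof (rule integral_le)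
      fix x assume x: "x \<in> E"
      have "\<bar>poly J y\<bar> \<le> C + \<eta>" if "y \<in> E" for y
        using J[OF that] Jv_le[OF that] by linarith
      then have "\<bar>poly (heat t J) x\<bar> \<le> C + \<eta>" using t x by (intro heat_abs_le) auto
      then have "\<bar>poly (heat t J) x * (poly q x - h x)\<bar> \<le> (C + \<eta>) * \<epsilon>"
        unfolding abs_mult using close[OF x] C0 \<eta> by (intro mult_mono) auto
      then show "poly (heat t J) x * poly q x \<le> poly (heat t J) x * h x + \<epsilon> * (C + \<eta>)"
        by (simp add: algebra_simps abs_le_iff)
    qed (intro integrable_continuous_interval continuous_intros cont)+
    also have "\<dots> = integral E (\<lambda>x. poly (heat t J) x * h x) + 2 * \<epsilon> * (C + \<eta>)"
      by (subst Henstock_Kurzweil_Integration.integral_add)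
        (intro integrable_continuous_interval continuous_intros cont | simp)+
    finally show ?thesis
      using stein_heat_bound[OF stein cont h t, of p] by (simp add: J_def)
  qed
  have "poly_fisher (heat t q) \<le> 2 / (exp (2 * t) - 1) * s + 2 * \<epsilon> * C"
  proof (rule field_le_epsilon)
    fix e :: real assume e: "0 < e"
    define \<eta> where "\<eta> = e / (2 * \<epsilon> + W + 1)"
    have \<eta>: "0 < \<eta>" using e cW \<epsilon>0 by (simp add: \<eta>_def)
    have "\<eta> * (2 * \<epsilon> + W) \<le> \<eta> * (2 * \<epsilon> + W + 1)" using \<eta> by (intro mult_left_mono) auto
    also have "\<dots> = e" using cW \<epsilon>0 by (simp add: \<eta>_def)
    finally show "poly_fisher (heat t q) \<le> 2 / (exp (2 * t) - 1) * s + 2 * \<epsilon> * C + e"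
      using key[OF \<eta>] by (simp add: algebra_simps)
  qed
  then show ?thesis by (simp add: C_def)
qed

text \<open>The decay of the Fisher information is used on \<open>[0, u]\<close> and the Stein bound on \<open>[u, T]\<close>, where
  \<open>2 / (exp (2 t) - 1)\<close> is the derivative of \<open>ln (1 - exp (- 2 t))\<close>. The error of the Stein bound
  grows with the length of the time interval, so the tail after \<open>T\<close> is left to the logarithmic Sobolev
  inequality.\<close>

lemma poly_HSI:
  assumes stein: "stein_bound h s" and cont: "continuous_on E h" and h: "\<And>x. x \<in> E \<Longrightarrow> 0 \<le> h x"
    and close: "\<And>x. x \<in> E \<Longrightarrow> \<bar>poly q x - h x\<bar> \<le> \<epsilon>"
    and m: "0 < m" "\<And>x. x \<in> E \<Longrightarrow> m \<le> poly q x"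
    and K: "\<And>x. x \<in> E \<Longrightarrow> \<bar>poly (pderiv q) x\<bar> \<le> K" "\<And>x. x \<in> E \<Longrightarrow> \<bar>poly (pderiv (pderiv q)) x\<bar> \<le> K"
    and u: "0 < u" "u \<le> T" and s: "0 \<le> s"
  defines "\<kappa> \<equiv> integral E (poly q) / 2"
  shows "poly_entropy q \<le> (1 - exp (- 2 * u)) / 2 * poly_fisher q - s * ln (1 - exp (- 2 * u))
    + 2 * \<epsilon> * (6 * K / m + K\<^sup>2 / m\<^sup>2) * T + exp (- 2 * T) / 2 * poly_fisher q + 2 * (\<kappa> * ln \<kappa>)"
proof -
  define C where "C = 2 * \<epsilon> * (6 * K / m + K\<^sup>2 / m\<^sup>2)"
  have pos: "0 < poly q x" if "x \<in> E" for x using m(1) m(2)[OF that] by linarith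
  have "0 \<le> K" "0 \<le> \<epsilon>" using K(1)[of 0] close[of 0] by auto
  then have C0: "0 \<le> C" using m(1) by (simp add: C_def)
  define G where "G t = poly_entropy (heat t q) + s * ln (1 - exp (- 2 * t)) + C * t" for t
  define G' where "G' t = - poly_fisher (heat t q) + s * (2 / (exp (2 * t) - 1)) + C" for t
  have "G u \<le> G T"
  proof (rule nondecreasing_within_Ici[of u T G G'])
    fix t :: real assume "u \<le> t"
    then have t: "0 < t" "0 \<le> t" using u by auto
    have e: "1 < exp (2 * t)" "exp (- 2 * t) < 1" using t by auto
    have "((\<lambda>t. s * ln (1 - exp (- 2 * t))) has_real_derivative s * (2 / (exp (2 * t) - 1))) (at t within {0..})"
      using e by (auto intro!: derivative_eq_intros simp: exp_minus field_simps)
    moreover have "((\<lambda>t. C * t) has_real_derivative C) (at t within {0..})"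
      by (auto intro!: derivative_eq_intros)
    ultimately show "(G has_real_derivative G' t) (at t within {0..})"
      unfolding G_def[abs_def] G'_def by (intro DERIV_add poly_entropy_deriv pos t)
    show "0 \<le> G' t"
      using stein_fisher_bound[OF stein cont h close m K t(1)] by (simp add: G'_def C_def mult.commute)
  qed (use u in auto)
  moreover have "s * ln (1 - exp (- 2 * T)) \<le> 0"
    using s u by (intro mult_nonneg_nonpos) auto
  moreover have "0 \<le> C * u" using C0 u by simp
  moreover have "poly_entropy (heat T q) \<le> exp (- 2 * T) / 2 * poly_fisher q + 2 * (\<kappa> * ln \<kappa>)"
    unfolding \<kappa>_def using u by (intro poly_log_sobolev pos) auto
  moreover have "poly_entropy q \<le> poly_entropy (heat u q) + (1 - exp (- 2 * u)) / 2 * poly_fisher q"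
    using poly_entropy_step[of q 0 u] pos u by (simp add: algebra_simps diff_divide_distrib)
  ultimately show ?thesis unfolding G_def C_def[symmetric] by linarith
qed


section \<open>The inequality for positive densities\<close>

lemma tendsto_of_abs_le:
  fixes a e :: "nat \<Rightarrow> real"
  assumes "\<And>n. \<bar>a n - l\<bar> \<le> e n" "e \<longlonglongrightarrow> 0"
  shows "a \<longlonglongrightarrow> l"
  by (rule LIM_zero_cancel, rule Lim_null_comparison[OF _ assms(2)]) (use assms(1) in auto)

lemma ex_poly_sequence:
  assumes d1: "\<And>x. x \<in> E \<Longrightarrow> (h has_real_derivative h1 x) (at x within E)"
    and d2: "\<And>x. x \<in> E \<Longrightarrow> (h1 has_real_derivative h2 x) (at x within E)"
    and c2: "continuous_on E h2" and m: "0 < m" "\<And>x. x \<in> E \<Longrightarrow> 2 * m \<le> h x"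
  defines "\<epsilon> \<equiv> \<lambda>n. m / real (Suc n)"
  shows "\<exists>q K. (\<forall>n. \<forall>x\<in>E. \<bar>poly (q n) x - h x\<bar> \<le> \<epsilon> n \<and> m \<le> poly (q n) x
       \<and> \<bar>poly (pderiv (q n)) x\<bar> \<le> K \<and> \<bar>poly (pderiv (pderiv (q n))) x\<bar> \<le> K)
     \<and> (\<lambda>n. poly_entropy (q n)) \<longlonglongrightarrow> integral E (\<lambda>x. h x * ln (h x))
     \<and> (\<lambda>n. poly_fisher (q n)) \<longlonglongrightarrow> integral E (\<lambda>x. (1 - x\<^sup>2) * (h1 x)\<^sup>2 / h x)
     \<and> (\<lambda>n. integral E (poly (q n))) \<longlonglongrightarrow> integral E h"
proof -
  have \<epsilon>: "0 < \<epsilon> n" "\<epsilon> n \<le> m" for n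
  proof -
    have "m / real (Suc n) \<le> m / 1" using m(1) by (intro divide_left_mono) auto
    then show "0 < \<epsilon> n" "\<epsilon> n \<le> m" using m(1) by (auto simp: \<epsilon>_def)
  qed
  have \<epsilon>_lim: "\<epsilon> \<longlonglongrightarrow> 0"
    unfolding \<epsilon>_def by (rule LIMSEQ_Suc[OF lim_const_over_n])
  have "\<forall>n. \<exists>p. \<forall>x\<in>E. \<bar>poly p x - h x\<bar> \<le> \<epsilon> n \<and> \<bar>poly (pderiv p) x - h1 x\<bar> \<le> \<epsilon> n \<and>
      \<bar>poly (pderiv (pderiv p)) x - h2 x\<bar> \<le> \<epsilon> n"
    using C2_poly_approx[OF d1 d2 c2] \<epsilon>(1) by blast
  from choice[OF this] obtain q where
    q: "\<And>n x. x \<in> E \<Longrightarrow> \<bar>poly (q n) x - h x\<bar> \<le> \<epsilon> n"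
      "\<And>n x. x \<in> E \<Longrightarrow> \<bar>poly (pderiv (q n)) x - h1 x\<bar> \<le> \<epsilon> n"
      "\<And>n x. x \<in> E \<Longrightarrow> \<bar>poly (pderiv (pderiv (q n))) x - h2 x\<bar> \<le> \<epsilon> n" by blast
  have bound: "\<exists>B. \<forall>x\<in>E. \<bar>f x\<bar> \<le> B" if "continuous_on E f" for f :: "real \<Rightarrow> real"
    using compact_continuous_image[OF that, THEN compact_imp_bounded] by (auto simp: bounded_iff)
  have c: "continuous_on E h" "continuous_on E h1"
    by (rule DERIV_continuous_on[OF d1] DERIV_continuous_on[OF d2]; assumption)+
  obtain B0 where B0: "\<And>x. x \<in> E \<Longrightarrow> \<bar>h x\<bar> \<le> B0" using bound[OF c(1)] by blast
  obtain B1 where B1: "\<And>x. x \<in> E \<Longrightarrow> \<bar>h1 x\<bar> \<le> B1" using bound[OF c(2)] by blast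
  obtain B2 where B2: "\<And>x. x \<in> E \<Longrightarrow> \<bar>h2 x\<bar> \<le> B2" using bound[OF c2] by blast
  define K where "K = max B1 B2 + m"
  define M where "M = B0 + m"
  have qm: "m \<le> poly (q n) x" "poly (q n) x \<le> M" and qK: "\<bar>poly (pderiv (q n)) x\<bar> \<le> K"
     "\<bar>poly (pderiv (pderiv (q n))) x\<bar> \<le> K" if x: "x \<in> E" for n x
    using q(1)[OF x, of n] q(2)[OF x, of n] q(3)[OF x, of n] \<epsilon>[of n] m(2)[OF x] B0[OF x] B1[OF x] B2[OF x]
    unfolding K_def M_def by linarith+
  have qpos: "0 < poly (q n) x" "poly (q n) x \<noteq> 0" if "x \<in> E" for n x
    using qm(1)[OF that, of n] m(1) by linarith+
  have hpos: "0 < h x" if "x \<in> E" for x using m(2)[OF that] m(1) by linarith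
  have lim: "(\<lambda>n. poly (q n) x) \<longlonglongrightarrow> h x" "(\<lambda>n. poly (pderiv (q n)) x) \<longlonglongrightarrow> h1 x" if x: "x \<in> E" for x
    by (rule tendsto_of_abs_le[OF _ \<epsilon>_lim], rule q, rule x)+
  have "(\<lambda>n. poly_entropy (q n)) \<longlonglongrightarrow> integral E (\<lambda>x. h x * ln (h x))"
    unfolding poly_entropy_def
  proof (rule dominated_convergence(2)[where h = "\<lambda>_. M * (M + 1 / m)"])
    show "(\<lambda>x. poly (q n) x * ln (poly (q n) x)) integrable_on E" for n
      by (intro integrable_continuous_interval continuous_intros) (use qpos in auto)
    show "norm (poly (q n) x * ln (poly (q n) x)) \<le> M * (M + 1 / m)" if x: "x \<in> E" for n x
      using qm[OF x, of n] abs_ln_le[OF m(1) qm[OF x], of n] m(1)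
      by (auto simp: abs_mult intro!: mult_mono)
    show "(\<lambda>n. poly (q n) x * ln (poly (q n) x)) \<longlonglongrightarrow> h x * ln (h x)" if x: "x \<in> E" for x
      using hpos[OF x] by (intro tendsto_intros lim[OF x]) auto
  qed auto
  moreover have "(\<lambda>n. poly_fisher (q n)) \<longlonglongrightarrow> integral E (\<lambda>x. (1 - x\<^sup>2) * (h1 x)\<^sup>2 / h x)"
    unfolding poly_fisher_def
  proof (rule dominated_convergence(2)[where h = "\<lambda>_. 1 * K\<^sup>2 / m"])
    show "(\<lambda>x. (1 - x\<^sup>2) * (poly (pderiv (q n)) x)\<^sup>2 / poly (q n) x) integrable_on E" for n
      by (intro integrable_continuous_interval continuous_intros) (use qpos in auto)
    show "norm ((1 - x\<^sup>2) * (poly (pderiv (q n)) x)\<^sup>2 / poly (q n) x) \<le> 1 * K\<^sup>2 / m" if x: "x \<in> E" for n x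
    proof -
      have "norm ((1 - x\<^sup>2) * (poly (pderiv (q n)) x)\<^sup>2 / poly (q n) x)
        = (1 - x\<^sup>2) * (poly (pderiv (q n)) x)\<^sup>2 / poly (q n) x"
        using qpos(1)[OF x, of n] one_minus_square_nonneg[OF x] by simp
      also have "\<dots> \<le> 1 * K\<^sup>2 / m"
        using one_minus_square_nonneg[OF x] power_mono[OF qK(1)[OF x, of n], of 2] qm(1)[OF x, of n] m(1)
        by (intro frac_le mult_mono) auto
      finally show ?thesis .
    qed
    show "(\<lambda>n. (1 - x\<^sup>2) * (poly (pderiv (q n)) x)\<^sup>2 / poly (q n) x) \<longlonglongrightarrow> (1 - x\<^sup>2) * (h1 x)\<^sup>2 / h x" if x: "x \<in> E" for x
      using hpos[OF x] by (intro tendsto_intros lim[OF x]) auto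
  qed auto
  moreover have "(\<lambda>n. integral E (poly (q n))) \<longlonglongrightarrow> integral E h"
  proof (rule dominated_convergence(2)[where h = "\<lambda>_. M"])
    show "norm (poly (q n) x) \<le> M" if x: "x \<in> E" for n x
      using qm[OF x, of n] m(1) by simp
    show "poly (q n) integrable_on E" for n
      by (intro integrable_continuous_interval continuous_on_poly continuous_on_id)
  qed (auto intro: lim)
  ultimately show ?thesis
    using q(1) qm(1) qK by (intro exI[of _ q] exI[of _ K]) blast
qed

lemma log_sobolev_C2:
  assumes d1: "\<And>x. x \<in> E \<Longrightarrow> (h has_real_derivative h1 x) (at x within E)"
    and d2: "\<And>x. x \<in> E \<Longrightarrow> (h1 has_real_derivative h2 x) (at x within E)"
    and c2: "continuous_on E h2" and m: "0 < m" "\<And>x. x \<in> E \<Longrightarrow> 2 * m \<le> h x"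
    and mass: "integral E h = 2"
  shows "integral E (\<lambda>x. h x * ln (h x)) \<le> integral E (\<lambda>x. (1 - x\<^sup>2) * (h1 x)\<^sup>2 / h x) / 2"
proof -
  obtain q K where q: "\<And>n x. x \<in> E \<Longrightarrow> m \<le> poly (q n) x"
    and lim: "(\<lambda>n. poly_entropy (q n)) \<longlonglongrightarrow> integral E (\<lambda>x. h x * ln (h x))"
      "(\<lambda>n. poly_fisher (q n)) \<longlonglongrightarrow> integral E (\<lambda>x. (1 - x\<^sup>2) * (h1 x)\<^sup>2 / h x)"
      "(\<lambda>n. integral E (poly (q n))) \<longlonglongrightarrow> 2"
    using ex_poly_sequence[OF d1 d2 c2 m] unfolding mass by blast
  define \<kappa> where "\<kappa> n = integral E (poly (q n)) / 2" for n
  have \<kappa>: "\<kappa> \<longlonglongrightarrow> 1" unfolding \<kappa>_def[abs_def] using tendsto_divide[OF lim(3) tendsto_const[of 2]] by simp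
  have "poly_entropy (q n) \<le> 1 / 2 * poly_fisher (q n) + 2 * (\<kappa> n * ln (\<kappa> n))" for n
  proof -
    have "0 < poly (q n) x" if "x \<in> E" for x using q[OF that, of n] m(1) by linarith
    from poly_log_sobolev[OF this order_refl] show ?thesis by (simp add: \<kappa>_def)
  qed
  moreover have "(\<lambda>n. 1 / 2 * poly_fisher (q n) + 2 * (\<kappa> n * ln (\<kappa> n)))
      \<longlonglongrightarrow> 1 / 2 * integral E (\<lambda>x. (1 - x\<^sup>2) * (h1 x)\<^sup>2 / h x) + 2 * (1 * ln 1)"
    by (intro tendsto_intros lim \<kappa>) auto
  ultimately show ?thesis
    using LIMSEQ_le[OF lim(1)] by fastforce
qed

text \<open>First the approximation error tends to \<open>0\<close> with \<open>T\<close> fixed, then \<open>T\<close> tends to infinity.\<close>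

lemma HSI_C2:
  assumes d1: "\<And>x. x \<in> E \<Longrightarrow> (h has_real_derivative h1 x) (at x within E)"
    and d2: "\<And>x. x \<in> E \<Longrightarrow> (h1 has_real_derivative h2 x) (at x within E)"
    and c2: "continuous_on E h2" and m: "0 < m" "\<And>x. x \<in> E \<Longrightarrow> 2 * m \<le> h x"
    and mass: "integral E h = 2" and stein: "stein_bound h s" and s: "0 \<le> s"
    and \<theta>: "0 < \<theta>" "\<theta> < 1"
  shows "integral E (\<lambda>x. h x * ln (h x)) \<le> \<theta> / 2 * integral E (\<lambda>x. (1 - x\<^sup>2) * (h1 x)\<^sup>2 / h x) - s * ln \<theta>"
    (is "?H \<le> \<theta> / 2 * ?I - s * ln \<theta>")
proof -
  obtain q K where q: "\<And>n x. x \<in> E \<Longrightarrow> \<bar>poly (q n) x - h x\<bar> \<le> m / real (Suc n)"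
      "\<And>n x. x \<in> E \<Longrightarrow> m \<le> poly (q n) x"
      "\<And>n x. x \<in> E \<Longrightarrow> \<bar>poly (pderiv (q n)) x\<bar> \<le> K"
      "\<And>n x. x \<in> E \<Longrightarrow> \<bar>poly (pderiv (pderiv (q n))) x\<bar> \<le> K"
    and lim: "(\<lambda>n. poly_entropy (q n)) \<longlonglongrightarrow> ?H" "(\<lambda>n. poly_fisher (q n)) \<longlonglongrightarrow> ?I"
      "(\<lambda>n. integral E (poly (q n))) \<longlonglongrightarrow> 2"
    using ex_poly_sequence[OF d1 d2 c2 m] unfolding mass by blast
  define C where "C = 6 * K / m + K\<^sup>2 / m\<^sup>2"
  define \<kappa> where "\<kappa> n = integral E (poly (q n)) / 2" for n
  have \<kappa>: "\<kappa> \<longlonglongrightarrow> 1" unfolding \<kappa>_def[abs_def] using tendsto_divide[OF lim(3) tendsto_const[of 2]] by simp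
  have ch: "continuous_on E h" by (rule DERIV_continuous_on[OF d1])
  have h: "0 \<le> h x" if "x \<in> E" for x using m(2)[OF that] m(1) by linarith
  \<comment> \<open>The time at which \<open>1 - exp (- 2 u) = \<theta>\<close>.\<close>
  define u where "u = - ln (1 - \<theta>) / 2"
  have u: "0 < u" "1 - exp (- 2 * u) = \<theta>" using \<theta> by (simp_all add: u_def)
  have bound: "?H \<le> \<theta> / 2 * ?I - s * ln \<theta> + exp (- 2 * T) / 2 * ?I" if T: "u \<le> T" for T
  proof -
    have "poly_entropy (q n) \<le> \<theta> / 2 * poly_fisher (q n) - s * ln \<theta>
      + 2 * (m / real (Suc n)) * C * T + exp (- 2 * T) / 2 * poly_fisher (q n) + 2 * (\<kappa> n * ln (\<kappa> n))" for n
      using poly_HSI[OF stein ch h q(1) m(1) q(2,3,4) u(1) T s, of n] unfolding u(2) C_def \<kappa>_def .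
    moreover have "(\<lambda>n. \<theta> / 2 * poly_fisher (q n) - s * ln \<theta>
        + 2 * (m / real (Suc n)) * C * T + exp (- 2 * T) / 2 * poly_fisher (q n) + 2 * (\<kappa> n * ln (\<kappa> n)))
      \<longlonglongrightarrow> \<theta> / 2 * ?I - s * ln \<theta> + 2 * 0 * C * T + exp (- 2 * T) / 2 * ?I + 2 * (1 * ln 1)"
      by (intro tendsto_intros lim \<kappa> LIMSEQ_Suc[OF lim_const_over_n]) auto
    ultimately have "?H \<le> \<theta> / 2 * ?I - s * ln \<theta> + 2 * 0 * C * T + exp (- 2 * T) / 2 * ?I + 2 * (1 * ln 1)"
      by (intro LIMSEQ_le[OF lim(1)]) auto
    then show ?thesis by simp
  qed
  have "(\<lambda>n. exp (- 2 * real n)) \<longlonglongrightarrow> 0"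
    by (rule filterlim_compose[OF exp_at_bot])
      (auto intro!: filterlim_tendsto_pos_mult_at_top[OF tendsto_const] filterlim_real_sequentially
        simp: filterlim_uminus_at_bot)
  then have "(\<lambda>n. \<theta> / 2 * ?I - s * ln \<theta> + exp (- 2 * real n) / 2 * ?I) \<longlonglongrightarrow> \<theta> / 2 * ?I - s * ln \<theta> + 0 / 2 * ?I"
    by (intro tendsto_intros) auto
  then have "?H \<le> \<theta> / 2 * ?I - s * ln \<theta> + 0 / 2 * ?I"
  proof (rule LIMSEQ_le_const, intro exI allI impI)
    fix n assume "nat \<lceil>u\<rceil> \<le> n"
    then have "u \<le> real n" by linarith
    then show "?H \<le> \<theta> / 2 * ?I - s * ln \<theta> + exp (- 2 * real n) / 2 * ?I" by (rule bound)
  qed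
  then show ?thesis by simp
qed


section \<open>From Stein kernels to the Stein bound\<close>

lemma has_derivative_D:
  assumes "f differentiable_on E" "x \<in> E"
  shows "(f has_real_derivative D f x) (at x within E)"
proof -
  have "\<exists>y. (f has_real_derivative y) (at x within E)"
    using assms unfolding differentiable_on_def real_differentiable_def by blast
  then obtain y where "(f has_real_derivative y) (at x within E)" by blast
  with D_unique[OF this \<open>x \<in> E\<close>] show ?thesis by simp
qed

lemma has_derivative_poly_cong:
  assumes "\<And>y. y \<in> E \<Longrightarrow> f y = poly p y" "x \<in> E"
  shows "(f has_real_derivative poly (pderiv p) x) (at x within E)"
  by (rule has_field_derivative_transform_within[where f = "poly p" and d = 1])
    (use assms in \<open>auto intro: poly_DERIV[THEN DERIV_subset]\<close>)

lemma D_iterate_poly: "x \<in> E \<Longrightarrow> (D ^^ n) (poly p) x = poly ((pderiv ^^ n) p) x"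
proof (induction n arbitrary: x)
  case (Suc n)
  show ?case using D_unique[OF has_derivative_poly_cong[OF Suc.IH Suc.prems] Suc.prems] by simp
qed simp

lemma smooth_poly: "smooth (poly p)"
  unfolding smooth_def differentiable_on_def real_differentiable_def
  using has_derivative_poly_cong[OF D_iterate_poly] by blast

lemma D_poly: "x \<in> E \<Longrightarrow> D (poly p) x = poly (pderiv p) x"
  and D_D_poly: "x \<in> E \<Longrightarrow> D (D (poly p)) x = poly (pderiv (pderiv p)) x"
  using D_iterate_poly[of x 1 p] D_iterate_poly[of x 2 p] by (simp_all add: numeral_2_eq_2)

lemma mu_density: "\<mu> = density (restrict_space lborel E) (\<lambda>_. ennreal (1 / 2))"
  unfolding \<mu>_def uniform_measure_def
proof (rule density_cong)
  show "(\<lambda>x. indicator E x / emeasure (restrict_space lborel E) E) \<in> borel_measurable (restrict_space lborel E)"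
    by (rule measurable_restrict_space1) measurable
  show "AE x in restrict_space lborel E. indicator E x / emeasure (restrict_space lborel E) E = ennreal (1 / 2)"
    by (auto simp: emeasure_restrict_space space_restrict_space intro!: AE_I2)
      (simp add: divide_ennreal[of 1 2, simplified, symmetric])
qed simp

lemma measurable_mu_iff: "measurable \<mu> N = measurable (restrict_space borel E) N"
  by (rule measurable_cong_sets) (auto simp: mu_density sets_restrict_space)

lemma continuous_measurable_mu: "continuous_on E f \<Longrightarrow> f \<in> borel_measurable \<mu>"
  for f :: "real \<Rightarrow> real"
  unfolding measurable_mu_iff by (rule borel_measurable_continuous_on_restrict)

lemma
  fixes f :: "real \<Rightarrow> real"
  assumes f: "continuous_on E f"
  shows integrable_mu: "integrable \<mu> f"
    and integral_mu: "(\<integral>x. f x \<partial>\<mu>) = integral E f / 2"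
proof -
  have set: "set_integrable lborel E f"
    by (rule borel_integrable_atLeastAtMost') (rule f)
  have meas: "f \<in> borel_measurable (restrict_space lborel E)"
    using borel_measurable_continuous_on_restrict[OF f]
    by (simp cong: measurable_cong_sets add: sets_restrict_space)
  have "integrable (restrict_space lborel E) f"
    using set by (simp add: integrable_restrict_space set_integrable_def)
  then show "integrable \<mu> f"
    unfolding mu_density using meas by (subst integrable_real_density) auto
  have "(\<integral>x. f x \<partial>\<mu>) = (\<integral>x. (1 / 2) * f x \<partial>restrict_space lborel E)"
    unfolding mu_density using meas by (subst integral_real_density) auto
  also have "\<dots> = (LINT x:E|lborel. f x) / 2"
    by (simp add: integral_restrict_space set_lebesgue_integral_def)
  also have "\<dots> = integral E f / 2"
    using set_borel_integral_eq_integral(2)[OF set] by simp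
  finally show "(\<integral>x. f x \<partial>\<mu>) = integral E f / 2" .
qed

lemma AE_mu_interior: "AE x in \<mu>. -1 < x \<and> x < 1"
proof -
  have "AE x in lborel. x \<notin> {-1, 1::real}"
    by (rule AE_not_in) (auto intro: countable_imp_null_set_lborel)
  then have "AE x in lborel. x \<in> E \<longrightarrow> -1 < x \<and> x < 1" by eventually_elim auto
  then show ?thesis
    unfolding mu_density by (auto simp: AE_density AE_restrict_space_iff)
qed

text \<open>Tested on a polynomial, the kernel identity reads \<open>- \<integral> L f d\<nu> = \<integral> (\<tau> - a) f'' d\<nu>\<close>. Off the
  endpoints the integrand is \<open>z w\<close> with \<open>z = \<tau> / a - 1\<close> and \<open>w = a f''\<close>, and
  \<open>2 z w \<le> c z\<^sup>2 + w\<^sup>2 / c\<close>.\<close>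

lemma stein_kernel_imp_stein_bound:
  assumes h: "continuous_on E h" "\<And>x. x \<in> E \<Longrightarrow> 0 \<le> h x"
    and \<nu>: "\<nu> = density \<mu> (\<lambda>x. ennreal (h x))"
    and stein: "stein_kernel \<nu> \<tau>"
    and s: "(\<integral>\<^sup>+ x. ennreal ((\<tau> x / (1 - x\<^sup>2) - 1)\<^sup>2) \<partial>\<nu>) = ennreal s" "0 \<le> s"
  shows "stein_bound h (2 * s)"
  unfolding stein_bound_def
proof (intro allI impI)
  fix f :: "real poly" and c :: real
  assume c: "0 < c"
  have space: "space \<nu> = E" by (simp add: \<nu>)
  have hm: "h \<in> borel_measurable \<mu>" by (rule continuous_measurable_mu[OF h(1)])
  have \<nu>_eq: "integrable \<nu> g" "(\<integral>x. g x \<partial>\<nu>) = integral E (\<lambda>x. g x * h x) / 2"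
    if g: "continuous_on E g" for g :: "real \<Rightarrow> real"
  proof -
    have gm: "g \<in> borel_measurable \<mu>" by (rule continuous_measurable_mu[OF g])
    have h0: "AE x in \<mu>. 0 \<le> h x" using h(2) by (auto intro!: AE_I2)
    have gh: "continuous_on E (\<lambda>x. h x * g x)" by (intro continuous_intros h g)
    show "integrable \<nu> g"
      unfolding \<nu> by (subst integrable_real_density[OF hm h0 gm]) (rule integrable_mu[OF gh])
    show "(\<integral>x. g x \<partial>\<nu>) = integral E (\<lambda>x. g x * h x) / 2"
      unfolding \<nu> integral_real_density[OF hm h0 gm] integral_mu[OF gh] by (simp add: mult.commute)
  qed
  let ?f1 = "poly (pderiv f)" and ?f2 = "poly (pderiv (pderiv f))"
  define z where "z x = \<tau> x / (1 - x\<^sup>2) - 1" for x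
  define w where "w x = (1 - x\<^sup>2) * ?f2 x" for x
  have \<tau>: "integrable \<nu> \<tau>" using stein by (simp add: stein_kernel_def)
  have f2m: "?f2 \<in> borel_measurable \<nu>"
    using continuous_measurable_mu[of ?f2] by (simp add: \<nu> continuous_intros)
  have \<tau>f2: "integrable \<nu> (\<lambda>x. \<tau> x * ?f2 x)"
  proof -
    have "continuous_on E ?f2" by (intro continuous_intros)
    then have "\<exists>B. \<forall>x\<in>E. \<bar>?f2 x\<bar> \<le> B"
      using compact_continuous_image[THEN compact_imp_bounded, of E ?f2] by (auto simp: bounded_iff)
    then obtain B where B: "\<And>x. x \<in> E \<Longrightarrow> \<bar>?f2 x\<bar> \<le> B" by blast
    show ?thesis
    proof (rule Bochner_Integration.integrable_bound)
      show "integrable \<nu> (\<lambda>x. B * \<tau> x)" using \<tau> by simp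
      show "(\<lambda>x. \<tau> x * ?f2 x) \<in> borel_measurable \<nu>"
        using \<tau> f2m by measurable
      have "\<bar>\<tau> x * ?f2 x\<bar> \<le> \<bar>B * \<tau> x\<bar>" if "x \<in> E" for x
        using mult_left_mono[OF B[OF that], of "\<bar>\<tau> x\<bar>"] B[OF that] by (simp add: abs_mult mult.commute)
      then show "AE x in \<nu>. norm (\<tau> x * ?f2 x) \<le> norm (B * \<tau> x)"
        using space by (auto intro!: AE_I2)
    qed
  qed
  have zm: "(\<lambda>x. (z x)\<^sup>2) \<in> borel_measurable \<nu>"
  proof -
    have "(\<lambda>x. x) \<in> borel_measurable \<nu>"
      using continuous_measurable_mu[of "\<lambda>x. x"] by (simp add: \<nu> continuous_intros)
    then show ?thesis unfolding z_def using \<tau> by measurable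
  qed
  have z: "integrable \<nu> (\<lambda>x. (z x)\<^sup>2)" "(\<integral>x. (z x)\<^sup>2 \<partial>\<nu>) = s"
  proof -
    show "integrable \<nu> (\<lambda>x. (z x)\<^sup>2)"
      using s zm by (intro integrableI_nonneg) (auto simp: z_def)
    have "(\<integral>x. (z x)\<^sup>2 \<partial>\<nu>) = enn2real (\<integral>\<^sup>+x. ennreal ((z x)\<^sup>2) \<partial>\<nu>)"
      using zm by (intro integral_eq_nn_integral) auto
    then show "(\<integral>x. (z x)\<^sup>2 \<partial>\<nu>) = s" using s by (simp add: z_def)
  qed
  have cw: "continuous_on E (\<lambda>x. (w x)\<^sup>2)" "continuous_on E w"
    unfolding w_def by (intro continuous_intros)+
  have cf1: "continuous_on E (\<lambda>x. 2 * x * ?f1 x)" by (intro continuous_intros)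
  have identity: "(\<integral>x. 2 * x * ?f1 x \<partial>\<nu>) = (\<integral>x. \<tau> x * ?f2 x \<partial>\<nu>)"
  proof -
    have "(\<integral>x. 2 * x * D (poly f) x \<partial>\<nu>) = (\<integral>x. \<tau> x * D (D (poly f)) x \<partial>\<nu>)"
      using stein smooth_poly unfolding stein_kernel_def by blast
    moreover have "(\<integral>x. 2 * x * D (poly f) x \<partial>\<nu>) = (\<integral>x. 2 * x * ?f1 x \<partial>\<nu>)"
      by (rule Bochner_Integration.integral_cong) (simp_all add: space D_poly)
    moreover have "(\<integral>x. \<tau> x * D (D (poly f)) x \<partial>\<nu>) = (\<integral>x. \<tau> x * ?f2 x \<partial>\<nu>)"
      by (rule Bochner_Integration.integral_cong) (simp_all add: space D_D_poly)
    ultimately show ?thesis by simp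
  qed
  have "(\<integral>x. poly (jacobi f) x \<partial>\<nu>) = (\<integral>x. w x - 2 * x * ?f1 x \<partial>\<nu>)"
    by (simp add: poly_jacobi w_def)
  also have "\<dots> = (\<integral>x. w x \<partial>\<nu>) - (\<integral>x. \<tau> x * ?f2 x \<partial>\<nu>)"
    by (subst Bochner_Integration.integral_diff[OF \<nu>_eq(1)[OF cw(2)] \<nu>_eq(1)[OF cf1]]) (simp add: identity)
  also have "\<dots> = (\<integral>x. w x - \<tau> x * ?f2 x \<partial>\<nu>)"
    by (rule Bochner_Integration.integral_diff[OF \<nu>_eq(1)[OF cw(2)] \<tau>f2, symmetric])
  finally have "- 2 * (\<integral>x. poly (jacobi f) x \<partial>\<nu>) = - 2 * (\<integral>x. w x - \<tau> x * ?f2 x \<partial>\<nu>)"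
    by (rule arg_cong)
  also have "\<dots> = (\<integral>x. - 2 * (w x - \<tau> x * ?f2 x) \<partial>\<nu>)"
    by (rule Bochner_Integration.integral_mult_right_zero[symmetric])
  also have "\<dots> \<le> (\<integral>x. c * (z x)\<^sup>2 + (w x)\<^sup>2 / c \<partial>\<nu>)"
  proof (rule integral_mono_AE)
    show "integrable \<nu> (\<lambda>x. - 2 * (w x - \<tau> x * ?f2 x))"
      by (intro Bochner_Integration.integrable_diff integrable_mult_right \<nu>_eq(1) cw \<tau>f2)
    show "integrable \<nu> (\<lambda>x. c * (z x)\<^sup>2 + (w x)\<^sup>2 / c)"
      by (intro Bochner_Integration.integrable_add integrable_mult_right integrable_divide \<nu>_eq(1) cw z)
    have "AE x in \<nu>. -1 < x \<and> x < 1"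
      unfolding \<nu> using hm AE_mu_interior by (subst AE_density) (auto elim: eventually_mono)
    then show "AE x in \<nu>. - 2 * (w x - \<tau> x * ?f2 x) \<le> c * (z x)\<^sup>2 + (w x)\<^sup>2 / c"
    proof eventually_elim
      case (elim x)
      then have "x\<^sup>2 < 1" by (simp add: abs_square_less_1 abs_less_iff)
      then have "\<tau> x * ?f2 x = (z x + 1) * w x" by (simp add: z_def w_def)
      then have "- 2 * (w x - \<tau> x * ?f2 x) = 2 * z x * w x" by (simp add: algebra_simps)
      moreover have "0 \<le> (c * z x - w x)\<^sup>2 / c" using c by simp
      moreover have "(c * z x - w x)\<^sup>2 / c = c * (z x)\<^sup>2 + (w x)\<^sup>2 / c - 2 * z x * w x"
        using c by (simp add: power2_eq_square field_simps)
      ultimately show ?case by linarith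
    qed
  qed
  also have "\<dots> = c * s + (\<integral>x. (w x)\<^sup>2 \<partial>\<nu>) / c"
    using z \<nu>_eq(1)[OF cw(1)] by (subst Bochner_Integration.integral_add) auto
  finally have "- 2 * (\<integral>x. poly (jacobi f) x \<partial>\<nu>) \<le> c * s + (\<integral>x. (w x)\<^sup>2 \<partial>\<nu>) / c" .
  moreover have "(\<integral>x. poly (jacobi f) x \<partial>\<nu>) = integral E (\<lambda>x. poly (jacobi f) x * h x) / 2"
    by (intro \<nu>_eq continuous_intros)
  ultimately show "- 2 * integral E (\<lambda>x. poly (jacobi f) x * h x)
     \<le> c * (2 * s) + integral E (\<lambda>x. ((1 - x\<^sup>2) * poly (pderiv (pderiv f)) x)\<^sup>2 * h x) / c"
    unfolding \<nu>_eq(2)[OF cw(1)] by (simp add: w_def field_simps)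
qed

text \<open>The constant density satisfies \<open>\<integral> L f = 0\<close>, so mixing with it scales the left side and the quadratic
  term of \<open>h\<close> by \<open>1 - \<delta>\<close> and adds a non-negative quadratic term on the right.\<close>

lemma stein_bound_mixture:
  assumes stein: "stein_bound h s" and h: "continuous_on E h" and s: "0 \<le> s" and \<delta>: "0 \<le> \<delta>" "\<delta> \<le> 1"
  shows "stein_bound (\<lambda>x. (1 - \<delta>) * h x + \<delta>) s"
  unfolding stein_bound_def
proof (intro allI impI)
  fix f :: "real poly" and c :: real
  assume c: "0 < c"
  define B where "B x = ((1 - x\<^sup>2) * poly (pderiv (pderiv f)) x)\<^sup>2" for x
  have split: "integral E (\<lambda>x. g x * ((1 - \<delta>) * h x + \<delta>)) = (1 - \<delta>) * integral E (\<lambda>x. g x * h x) + \<delta> * integral E g"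
    if g: "continuous_on E g" for g :: "real \<Rightarrow> real"
  proof -
    have "integral E (\<lambda>x. g x * ((1 - \<delta>) * h x + \<delta>)) = integral E (\<lambda>x. (1 - \<delta>) * (g x * h x) + \<delta> * g x)"
      by (simp add: algebra_simps)
    also have "\<dots> = (1 - \<delta>) * integral E (\<lambda>x. g x * h x) + \<delta> * integral E g"
      by (subst Henstock_Kurzweil_Integration.integral_add)
        (intro integrable_continuous_interval continuous_intros g h | simp)+
    finally show ?thesis .
  qed
  have cB: "continuous_on E B" unfolding B_def by (intro continuous_intros)
  have "integral E (\<lambda>x. poly (jacobi f) x) = 0"
    using pairing_jacobi[of f "[:1:]"] by (simp add: pairing_def jacobi_def)
  then have L: "integral E (\<lambda>x. poly (jacobi f) x * ((1 - \<delta>) * h x + \<delta>))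
      = (1 - \<delta>) * integral E (\<lambda>x. poly (jacobi f) x * h x)"
    by (subst split) (auto intro: continuous_intros)
  have "- 2 * integral E (\<lambda>x. poly (jacobi f) x * h x) \<le> c * s + integral E (\<lambda>x. B x * h x) / c"
    using stein c unfolding stein_bound_def B_def by blast
  from mult_left_mono[OF this, of "1 - \<delta>"] \<delta>
  have "- 2 * ((1 - \<delta>) * integral E (\<lambda>x. poly (jacobi f) x * h x))
      \<le> (1 - \<delta>) * (c * s) + (1 - \<delta>) * integral E (\<lambda>x. B x * h x) / c"
    by (simp add: algebra_simps)
  also have "\<dots> \<le> c * s + integral E (\<lambda>x. B x * ((1 - \<delta>) * h x + \<delta>)) / c"
  proof (rule add_mono)
    show "(1 - \<delta>) * (c * s) \<le> c * s"
      using \<delta> c s by (intro mult_left_le_one_le) auto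
    have "0 \<le> integral E B"
      by (intro Henstock_Kurzweil_Integration.integral_nonneg integrable_continuous_interval cB) (simp add: B_def)
    then show "(1 - \<delta>) * integral E (\<lambda>x. B x * h x) / c \<le> integral E (\<lambda>x. B x * ((1 - \<delta>) * h x + \<delta>)) / c"
      unfolding split[OF cB] using \<delta> c by (intro divide_right_mono) auto
  qed
  finally show "- 2 * integral E (\<lambda>x. poly (jacobi f) x * ((1 - \<delta>) * h x + \<delta>))
     \<le> c * s + integral E (\<lambda>x. ((1 - x\<^sup>2) * poly (pderiv (pderiv f)) x)\<^sup>2 * ((1 - \<delta>) * h x + \<delta>)) / c"
    unfolding L B_def .
qed


section \<open>Removing the positivity assumption\<close>

lemma abs_mult_ln_le:
  fixes y :: real
  assumes "0 \<le> y" "y \<le> M"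
  shows "\<bar>y * ln y\<bar> \<le> M * M + 1"
proof (cases "y = 0")
  case False
  then have y: "0 < y" using assms by simp
  have "ln y \<le> y" "- ln y \<le> 1 / y - 1"
    using ln_le_minus_one[OF y] ln_le_minus_one[of "1 / y"] y by (auto simp: ln_div)
  then have "y * ln y \<le> y * y" "y * (- ln y) \<le> y * (1 / y - 1)"
    using y by (intro mult_left_mono; simp)+
  moreover have "y * (1 / y - 1) \<le> 1" using y by (simp add: algebra_simps)
  moreover have "y * y \<le> M * M" using assms by (intro mult_mono) auto
  moreover have "0 \<le> y * y" "y * (- ln y) = - (y * ln y)" by simp_all
  ultimately show ?thesis unfolding abs_le_iff by linarith
qed simp

text \<open>Bound the logarithm of the mixture from below by those of its two summands.\<close>

lemma mult_ln_mixture_ge: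
  fixes y :: real
  assumes "0 \<le> y" "0 < \<delta>" "\<delta> < 1"
  shows "(1 - \<delta>) * (y * ln y) + (1 - \<delta>) * ln (1 - \<delta>) * y + \<delta> * ln \<delta>
    \<le> ((1 - \<delta>) * y + \<delta>) * ln ((1 - \<delta>) * y + \<delta>)"
proof -
  define Y where "Y = (1 - \<delta>) * y + \<delta>"
  have Y: "\<delta> \<le> Y" "(1 - \<delta>) * y \<le> Y" using assms by (auto simp: Y_def)
  then have "ln \<delta> \<le> ln Y" using assms by (subst ln_le_cancel_iff) auto
  then have 1: "\<delta> * ln \<delta> \<le> \<delta> * ln Y" using assms by (intro mult_left_mono) auto
  have 2: "(1 - \<delta>) * (y * ln y) + (1 - \<delta>) * ln (1 - \<delta>) * y \<le> (1 - \<delta>) * y * ln Y"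
  proof (cases "y = 0")
    case False
    then have y: "0 < y" using assms by simp
    have "ln (1 - \<delta>) + ln y = ln ((1 - \<delta>) * y)" using y assms by (simp add: ln_mult)
    also have "\<dots> \<le> ln Y" using Y y assms by (subst ln_le_cancel_iff) auto
    finally have "((1 - \<delta>) * y) * (ln (1 - \<delta>) + ln y) \<le> ((1 - \<delta>) * y) * ln Y"
      using y assms by (intro mult_left_mono) auto
    then show ?thesis by (simp add: algebra_simps)
  qed simp
  have "((1 - \<delta>) * y + \<delta>) * ln Y = (1 - \<delta>) * y * ln Y + \<delta> * ln Y" by (simp add: algebra_simps)
  then show ?thesis using 1 2 unfolding Y_def[symmetric] by linarith
qed

text \<open>A lower bound for the entropies of the mixtures suffices: the preceding pointwise bound is
  integrated and \<open>\<delta>\<close> tends to \<open>0\<close>, where \<open>\<delta> ln \<delta>\<close> vanishes.\<close>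

lemma entropy_le_of_mixtures:
  assumes h: "continuous_on E h" "\<And>x. x \<in> E \<Longrightarrow> 0 \<le> h x" and mass: "integral E h = 2"
    and bound: "\<And>\<delta>. 0 < \<delta> \<Longrightarrow> \<delta> < 1 \<Longrightarrow>
      integral E (\<lambda>x. ((1 - \<delta>) * h x + \<delta>) * ln ((1 - \<delta>) * h x + \<delta>)) / 2 \<le> B"
  shows "entropy_H h \<le> B"
proof -
  interpret prob_space \<mu> by (rule prob_space_mu)
  have "\<exists>M. \<forall>x\<in>E. \<bar>h x\<bar> \<le> M"
    using compact_continuous_image[OF h(1), THEN compact_imp_bounded] by (auto simp: bounded_iff)
  then obtain M where "\<forall>x\<in>E. \<bar>h x\<bar> \<le> M" by blast
  then have M: "h x \<le> M" if "x \<in> E" for x using that abs_le_D1 by blast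
  have hm: "h \<in> borel_measurable \<mu>" by (rule continuous_measurable_mu[OF h(1)])
  have int: "integrable \<mu> (\<lambda>x. h x * ln (h x))"
  proof (rule integrable_const_bound)
    show "AE x in \<mu>. norm (h x * ln (h x)) \<le> M * M + 1"
      using abs_mult_ln_le[OF h(2) M] by (auto intro!: AE_I2)
    show "(\<lambda>x. h x * ln (h x)) \<in> borel_measurable \<mu>" using hm by measurable
  qed
  have ih: "integrable \<mu> h" "(\<integral>x. h x \<partial>\<mu>) = 1"
    using integrable_mu[OF h(1)] integral_mu[OF h(1)] mass by simp_all
  have "(1 - \<delta>) * entropy_H h + (1 - \<delta>) * ln (1 - \<delta>) + \<delta> * ln \<delta> \<le> B" if \<delta>: "0 < \<delta>" "\<delta> < 1" for \<delta>
  proof -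
    let ?Y = "\<lambda>x. ((1 - \<delta>) * h x + \<delta>) * ln ((1 - \<delta>) * h x + \<delta>)"
    have "(1 - \<delta>) * h x + \<delta> \<noteq> 0" if "x \<in> E" for x
      using \<delta> mult_nonneg_nonneg[OF _ h(2)[OF that], of "1 - \<delta>"] by auto
    then have cY: "continuous_on E ?Y" by (intro continuous_intros h) auto
    have "(1 - \<delta>) * entropy_H h + (1 - \<delta>) * ln (1 - \<delta>) + \<delta> * ln \<delta>
      = (\<integral>x. (1 - \<delta>) * (h x * ln (h x)) + (1 - \<delta>) * ln (1 - \<delta>) * h x + \<delta> * ln \<delta> \<partial>\<mu>)"
      using int ih prob_space by (simp add: entropy_H_def)
    also have "\<dots> \<le> (\<integral>x. ?Y x \<partial>\<mu>)"
    proof (rule integral_mono)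
      show "integrable \<mu> (\<lambda>x. (1 - \<delta>) * (h x * ln (h x)) + (1 - \<delta>) * ln (1 - \<delta>) * h x + \<delta> * ln \<delta>)"
        using int ih by simp
    qed (use integrable_mu[OF cY] mult_ln_mixture_ge[OF h(2) \<delta>] in auto)
    also have "\<dots> \<le> B" using bound[OF \<delta>] integral_mu[OF cY] by simp
    finally show ?thesis .
  qed
  note key = this
  define d where "d n = 1 / real (Suc (Suc n))" for n
  have d: "0 < d n" "d n < 1" for n by (auto simp: d_def)
  have d0: "d \<longlonglongrightarrow> 0"
    unfolding d_def[abs_def] by (rule LIMSEQ_Suc[OF LIMSEQ_Suc[OF lim_1_over_n]])
  have "(\<lambda>n. - (ln (real n) / real n)) \<longlonglongrightarrow> - 0"
    by (intro tendsto_minus lim_ln_over_n)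
  from LIMSEQ_Suc[OF LIMSEQ_Suc[OF this]] have dln: "(\<lambda>n. d n * ln (d n)) \<longlonglongrightarrow> 0"
    by (simp add: d_def ln_div del: of_nat_Suc)
  have "(\<lambda>n. (1 - d n) * entropy_H h + (1 - d n) * ln (1 - d n) + d n * ln (d n))
      \<longlonglongrightarrow> (1 - 0) * entropy_H h + (1 - 0) * ln (1 - 0) + 0"
    by (intro tendsto_intros d0 dln) auto
  then have "(1 - 0) * entropy_H h + (1 - 0) * ln (1 - 0) + 0 \<le> B"
    by (rule LIMSEQ_le_const2) (use key d in auto)
  then show ?thesis by simp
qed

lemma derivative_eq_0_at_zero:
  assumes h: "\<And>x. x \<in> E \<Longrightarrow> 0 \<le> h x" and d: "(h has_real_derivative y) (at x within E)"
    and x: "-1 < x" "x < 1" "h x = 0"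
  shows "y = 0"
proof (rule DERIV_local_min)
  have "x \<in> interior E" using x by simp
  from at_within_interior[OF this] show "(h has_real_derivative y) (at x)" using d by simp
  show "0 < min (x + 1) (1 - x)" using x by simp
  show "\<forall>y. \<bar>x - y\<bar> < min (x + 1) (1 - x) \<longrightarrow> h x \<le> h y"
    using h x by (auto simp: abs_less_iff)
qed

text \<open>Pointwise the integrand decreases. At a zero of \<open>h\<close>, where \<open>fisher_I\<close> has integrand \<open>0\<close> by division
  by zero, the integrand for the mixture vanishes too: inside the interval \<open>h\<close> has a minimum, so
  \<open>h' = 0\<close>, and at the endpoints the weight is \<open>0\<close>.\<close>

lemma fisher_mixture_le:
  assumes h: "\<And>x. x \<in> E \<Longrightarrow> 0 \<le> h x"
    and d1: "\<And>x. x \<in> E \<Longrightarrow> (h has_real_derivative D h x) (at x within E)"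
    and c1: "continuous_on E (D h)" and \<delta>: "0 < \<delta>" "\<delta> < 1"
  shows "ennreal (integral E (\<lambda>x. (1 - x\<^sup>2) * ((1 - \<delta>) * D h x)\<^sup>2 / ((1 - \<delta>) * h x + \<delta>)) / 2) \<le> fisher_I h"
proof -
  let ?g = "\<lambda>x. (1 - x\<^sup>2) * ((1 - \<delta>) * D h x)\<^sup>2 / ((1 - \<delta>) * h x + \<delta>)"
  have pos: "0 < (1 - \<delta>) * h x + \<delta>" if "x \<in> E" for x
    using \<delta> h[OF that] by (intro add_nonneg_pos mult_nonneg_nonneg) auto
  have ch: "continuous_on E h" by (rule DERIV_continuous_on[OF d1])
  have cg: "continuous_on E ?g" using pos by (intro continuous_intros ch c1) force
  have g0: "0 \<le> ?g x" if "x \<in> E" for x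
    using pos[OF that] one_minus_square_nonneg[OF that] by simp
  have "ennreal (integral E ?g / 2) = (\<integral>\<^sup>+x. ennreal (?g x) \<partial>\<mu>)"
    using integrable_mu[OF cg] g0 unfolding integral_mu[OF cg, symmetric]
    by (intro nn_integral_eq_integral[symmetric]) (auto intro!: AE_I2)
  also have "\<dots> \<le> fisher_I h"
    unfolding fisher_I_def
  proof (rule nn_integral_mono, rule ennreal_leI)
    fix x assume "x \<in> space \<mu>"
    then have x: "x \<in> E" by simp
    show "?g x \<le> (1 - x\<^sup>2) * (D h x)\<^sup>2 / h x"
    proof (cases "h x = 0")
      case True
      have "(1 - x\<^sup>2) * (D h x)\<^sup>2 = 0"
      proof (cases "-1 < x \<and> x < 1")
        case True
        then show ?thesis using derivative_eq_0_at_zero[OF h d1[OF x]] \<open>h x = 0\<close> by simp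
      next
        case False
        then have "x = 1 \<or> x = -1" using x by auto
        then show ?thesis by auto
      qed
      then show ?thesis using True by auto
    next
      case False
      then have hx: "0 < h x" using h[OF x] by simp
      have "?g x = (1 - x\<^sup>2) * (D h x)\<^sup>2 * (1 - \<delta>)\<^sup>2 / ((1 - \<delta>) * h x + \<delta>)"
        by (simp add: power_mult_distrib)
      also have "\<dots> \<le> (1 - x\<^sup>2) * (D h x)\<^sup>2 * (1 - \<delta>) / ((1 - \<delta>) * h x)"
        using hx \<delta> one_minus_square_nonneg[OF x] 
        by (intro frac_le mult_left_mono) (auto simp: power2_eq_square mult_left_le_one_le)
      also have "\<dots> = (1 - x\<^sup>2) * (D h x)\<^sup>2 / h x" using \<delta> by simp
      finally show ?thesis .
    qed
  qed
  finally show ?thesis .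
qed


text \<open>The optimisation over \<open>\<theta>\<close>, with the conventions for infinite and zero arguments. If \<open>S = 0\<close> the
  bound is \<open>0\<close> even for infinite \<open>I\<close>, so that case needs a hypothesis of its own.\<close>

lemma HSI_bound_geI:
  assumes stein: "\<And>s \<theta>. S\<^sup>2 = ennreal s \<Longrightarrow> 0 \<le> s \<Longrightarrow> I < \<infinity> \<Longrightarrow> 0 < \<theta> \<Longrightarrow> \<theta> < 1 \<Longrightarrow>
      H \<le> \<theta> / 2 * enn2real I - s * ln \<theta>"
    and sobolev: "I < \<infinity> \<Longrightarrow> H \<le> enn2real I / 2"
    and exact: "S = 0 \<Longrightarrow> H \<le> 0"
  shows "ennreal H \<le> HSI_bound S I"
proof (cases "S = \<infinity>")
  case True
  show ?thesis
  proof (cases I)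
    case (real r)
    then have "H \<le> r / 2" using sobolev by simp
    then show ?thesis using True real by (simp add: HSI_bound_def ennreal_leI divide_ennreal[of r 2, simplified])
  next
    case top
    then show ?thesis using True by (simp add: HSI_bound_def ennreal_top_divide)
  qed
next
  case False
  then obtain \<sigma> where \<sigma>: "S = ennreal \<sigma>" "0 \<le> \<sigma>" by (cases S) auto
  show ?thesis
  proof (cases "\<sigma> = 0")
    case True
    then have "H \<le> 0" using exact \<sigma> by simp
    then show ?thesis by (simp add: ennreal_neg)
  next
    case False
    define s where "s = \<sigma>\<^sup>2"
    have s: "S\<^sup>2 = ennreal s" "0 < s" using \<sigma> False by (simp_all add: s_def ennreal_power)
    have 2: "2 * S\<^sup>2 = ennreal (2 * s)" using s by (simp add: ennreal_mult)
    show ?thesis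
    proof (cases I)
      case top
      then have "I / (2 * S\<^sup>2) = \<infinity>" unfolding 2 by (simp add: ennreal_top_divide)
      then have "HSI_bound S I = \<infinity>"
        using \<open>S \<noteq> \<infinity>\<close> s by (simp add: HSI_bound_def ePsi_def ennreal_mult_top)
      then show ?thesis by simp
    next
      case (real i)
      define r where "r = i / (2 * s)"
      have r: "0 \<le> r" "s * r = i / 2" using real s by (simp_all add: r_def)
      have "I / (2 * S\<^sup>2) = ennreal r"
        unfolding 2 r_def using real s by (simp add: divide_ennreal)
      then have eq: "HSI_bound S I = ennreal (s * \<Psi> r)"
        using \<open>S \<noteq> \<infinity>\<close> s r by (simp add: HSI_bound_def ePsi_def ennreal_mult')
      have "H \<le> s * \<Psi> r"
      proof (cases "1 < r")
        case True
        \<comment> \<open>The minimiser \<open>\<theta> = 2 s / i\<close>.\<close>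
        then have "H \<le> (1 / r) / 2 * i - s * ln (1 / r)"
          using stein[OF s(1), of "1 / r"] real s by simp
        also have "(1 / r) / 2 * i = s"
        proof -
          have "(1 / r) / 2 * i = (i / 2) / r" by simp
          also have "\<dots> = s" unfolding r(2)[symmetric] using True by simp
          finally show ?thesis .
        qed
        also have "s - s * ln (1 / r) = s * \<Psi> r"
          using True by (simp add: \<Psi>_def ln_div algebra_simps)
        finally show ?thesis .
      next
        case False
        then have "\<Psi> r = r" by (cases "r = 1") (auto simp: \<Psi>_def)
        then show ?thesis using sobolev real r by simp
      qed
      then show ?thesis unfolding eq by (rule ennreal_leI)
    qed
  qed
qed

theorem proposition4p4:
  fixes h \<tau> :: "real \<Rightarrow> real" and \<nu> :: "real measure"
  assumes "smooth h"
    and "\<And>x. x \<in> {-1..1} \<Longrightarrow> 0 \<le> h x"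
    and "\<nu> = density \<mu> (\<lambda>x. ennreal (h x))"
    and "prob_space \<nu>"
    and "stein_kernel \<nu> \<tau>"
  shows "ennreal (entropy_H h) \<le> HSI_bound (stein_discrepancy \<nu> \<tau>) (fisher_I h)"
proof -
  note h0 = assms(2) and \<nu> = assms(3)
  have diff: "(D ^^ n) h differentiable_on E" for n using assms(1) by (simp add: smooth_def)
  have d1: "(h has_real_derivative D h x) (at x within E)"
    and d2: "(D h has_real_derivative D (D h) x) (at x within E)" if "x \<in> E" for x
    using has_derivative_D[OF diff[of 0] that] has_derivative_D[OF diff[of 1] that] by simp_all
  have c2: "continuous_on E (D (D h))"
    using differentiable_imp_continuous_on[OF diff[of 2]] by (simp add: numeral_2_eq_2)
  have c1: "continuous_on E (D h)" by (rule DERIV_continuous_on[OF d2])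
  have ch: "continuous_on E h" by (rule DERIV_continuous_on[OF d1])
  have mass: "integral E h = 2"
  proof -
    have "(\<integral>\<^sup>+x. ennreal (h x) \<partial>\<mu>) = (\<integral>\<^sup>+x. ennreal (h x) * indicator (space \<mu>) x \<partial>\<mu>)"
      by (intro nn_integral_cong) simp
    also have "\<dots> = emeasure \<nu> (space \<mu>)"
      using continuous_measurable_mu[OF ch] sets.top[of \<mu>] unfolding \<nu> by (subst emeasure_density) auto
    also have "\<dots> = 1" using prob_space.emeasure_space_1[OF assms(4)] by (simp add: \<nu>)
    finally have "(\<integral>\<^sup>+x. ennreal (h x) \<partial>\<mu>) = 1" .
    moreover have "(\<integral>\<^sup>+x. ennreal (h x) \<partial>\<mu>) = ennreal (integral E h / 2)"
      using integrable_mu[OF ch] h0 unfolding integral_mu[OF ch, symmetric]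
      by (intro nn_integral_eq_integral) (auto intro!: AE_I2)
    ultimately show ?thesis by simp
  qed
  define I where "I = fisher_I h"
  define S where "S = stein_discrepancy \<nu> \<tau>"
  define X where "X \<delta> = integral E (\<lambda>x. (1 - x\<^sup>2) * ((1 - \<delta>) * D h x)\<^sup>2 / ((1 - \<delta>) * h x + \<delta>)) / 2" for \<delta>
  define Y where "Y \<delta> = integral E (\<lambda>x. ((1 - \<delta>) * h x + \<delta>) * ln ((1 - \<delta>) * h x + \<delta>)) / 2" for \<delta>
  have X_le: "X \<delta> \<le> enn2real I" if "0 < \<delta>" "\<delta> < 1" "I < \<infinity>" for \<delta>
  proof -
    have "ennreal (X \<delta>) \<le> I" unfolding X_def I_def by (rule fisher_mixture_le[OF h0 d1 c1 that(1,2)])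
    then show ?thesis using that(3) by (cases I) (auto simp: ennreal_le_iff)
  qed
  have mix:
    "((\<lambda>x. (1 - \<delta>) * h x + \<delta>) has_real_derivative (1 - \<delta>) * D h x) (at x within E)"
    "((\<lambda>x. (1 - \<delta>) * D h x) has_real_derivative (1 - \<delta>) * D (D h) x) (at x within E)"
    if "x \<in> E" for x \<delta>
    using d1[OF that] d2[OF that] by (auto intro!: derivative_eq_intros)
  have mix_c2: "continuous_on E (\<lambda>x. (1 - \<delta>) * D (D h) x)" for \<delta> by (intro continuous_intros c2)
  have mix_ge: "2 * (\<delta> / 2) \<le> (1 - \<delta>) * h x + \<delta>" if "\<delta> < 1" "x \<in> E" for x \<delta>
    using h0[OF that(2)] that(1) by simp
  have mix_mass: "integral E (\<lambda>x. (1 - \<delta>) * h x + \<delta>) = 2" for \<delta>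
  proof -
    have "integral E (\<lambda>x. (1 - \<delta>) * h x + \<delta>) = integral E (\<lambda>x. (1 - \<delta>) * h x) + integral E (\<lambda>x. \<delta>)"
      by (intro Henstock_Kurzweil_Integration.integral_add integrable_continuous_interval continuous_intros ch)
    also have "integral E (\<lambda>x. (1 - \<delta>) * h x) = (1 - \<delta>) * 2" by (simp add: mass)
    finally show ?thesis by (simp add: algebra_simps)
  qed
  have sobolev: "Y \<delta> \<le> X \<delta> / 2" if \<delta>: "0 < \<delta>" "\<delta> < 1" for \<delta>
  proof -
    have "0 < \<delta> / 2" using \<delta> by simp
    from log_sobolev_C2[OF mix mix_c2 this mix_ge[OF \<delta>(2)] mix_mass] show ?thesis
      by (simp add: X_def Y_def)
  qed
  have hsi: "Y \<delta> \<le> \<theta> / 2 * X \<delta> - s * ln \<theta>"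
    if \<delta>: "0 < \<delta>" "\<delta> < 1" and s: "S\<^sup>2 = ennreal s" "0 \<le> s" and \<theta>: "0 < \<theta>" "\<theta> < 1" for \<delta> s \<theta>
  proof -
    have "(\<integral>\<^sup>+ x. ennreal ((\<tau> x / (1 - x\<^sup>2) - 1)\<^sup>2) \<partial>\<nu>) = ennreal s"
      using s by (simp add: S_def stein_discrepancy_def esqrt_power2)
    from stein_kernel_imp_stein_bound[OF ch h0 \<nu> assms(5) this s(2)]
    have bound: "stein_bound (\<lambda>x. (1 - \<delta>) * h x + \<delta>) (2 * s)"
      using ch s \<delta> by (intro stein_bound_mixture) auto
    have pos: "0 < \<delta> / 2" "0 \<le> 2 * s" using \<delta> s by simp_all
    show ?thesis
      using HSI_C2[OF mix mix_c2 pos(1) mix_ge[OF \<delta>(2)] mix_mass bound pos(2) \<theta>]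
      by (simp add: X_def Y_def field_simps)
  qed
  note entropy_le = entropy_le_of_mixtures[OF ch h0 mass, folded Y_def]
  have "ennreal (entropy_H h) \<le> HSI_bound S I"
  proof (rule HSI_bound_geI)
    fix s \<theta> assume s: "S\<^sup>2 = ennreal s" "0 \<le> s" and I: "I < \<infinity>" and \<theta>: "0 < \<theta>" "\<theta> < (1::real)"
    show "entropy_H h \<le> \<theta> / 2 * enn2real I - s * ln \<theta>"
    proof (rule entropy_le)
      fix \<delta> :: real assume \<delta>: "0 < \<delta>" "\<delta> < 1"
      have "\<theta> / 2 * X \<delta> \<le> \<theta> / 2 * enn2real I"
        using X_le[OF \<delta> I] \<theta> by (intro mult_left_mono) auto
      then show "Y \<delta> \<le> \<theta> / 2 * enn2real I - s * ln \<theta>" using hsi[OF \<delta> s \<theta>] by linarith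
    qed
  next
    assume I: "I < \<infinity>"
    show "entropy_H h \<le> enn2real I / 2"
    proof (rule entropy_le)
      fix \<delta> :: real assume \<delta>: "0 < \<delta>" "\<delta> < 1"
      show "Y \<delta> \<le> enn2real I / 2" using sobolev[OF \<delta>] X_le[OF \<delta> I] by linarith
    qed
  next
    assume "S = 0"
    then have s: "S\<^sup>2 = ennreal 0" by simp
    show "entropy_H h \<le> 0"
    proof (rule entropy_le)
      fix \<delta> :: real assume \<delta>: "0 < \<delta>" "\<delta> < 1"
      \<comment> \<open>For a positive mixture the Fisher information is a real number, so letting \<open>\<theta>\<close> tend to \<open>0\<close>
         is conclusive even when the Fisher information of \<open>h\<close> is not known to be finite.\<close>
      define \<theta> where "\<theta> n = 1 / real (Suc (Suc n))" for n
      have le: "Y \<delta> \<le> \<theta> n / 2 * X \<delta>" for n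
        using hsi[OF \<delta> s order_refl, of "\<theta> n"] by (simp add: \<theta>_def)
      have "(\<lambda>n. \<theta> n / 2 * X \<delta>) \<longlonglongrightarrow> 0 / 2 * X \<delta>"
        unfolding \<theta>_def by (intro tendsto_intros LIMSEQ_Suc[OF LIMSEQ_Suc[OF lim_1_over_n]]) auto
      then have "Y \<delta> \<le> 0 / 2 * X \<delta>" by (rule LIMSEQ_le_const) (use le in auto)
      then show "Y \<delta> \<le> 0" by simp
    qed
  qed
  then show ?thesis by (simp add: S_def I_def)
qed

end
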